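(* Let $\mathcal{E}$ be a locally presentable and locally cartesian closed category equipped with a functorial cylinder $I\otimes(-)$ with contractions and connections such that $I\otimes(-)$ has a right adjoint. Let $(\mathsf{Cof},\mathsf{TrivFib})$ be a suitable weak factorization system on $\mathcal{E}$, cofibrantly generated by a set of maps $\mathcal{I}$. Let $\mathcal{I}_\otimes=\{\delta^k\hat\otimes i \mid k\in\{0,1\},\ i\in\mathcal{I}\}$, let $\mathsf{Fib}$ be the class of maps with the right lifting property with respect to all maps in $\mathcal{I}_\otimes$, and let $\mathsf{TrivCof}$ be the class of maps with the left lifting property with respect to all maps in $\mathsf{Fib}$. Then $(\mathsf{TrivCof},\mathsf{Fib})$ is a weak factorization system on $\mathcal{E}$.
   Context: A functorial cylinder on $\mathcal{E}$ is an endofunctor $I\otimes(-)$ of $\mathcal{E}$ with natural transformations $\delta^0\otimes(-),\delta^1\otimes(-)\colon \mathrm{Id}\to I\otimes(-)$ (the endpoint inclusions). It has contractions if there is a natural transformation $\varepsilon\otimes(-)\colon I\otimes(-)\to\mathrm{Id}$ with $(\varepsilon\otimes X)\circ(\delta^k\otimes X)=\mathrm{id}_X$ for $k=0,1$. It then has connections if for $k\in\{0,1\}$ there is a natural transformation $c^k\otimes(-)\colon I\otimes I\otimes(-)\to I\otimes(-)$ (where $I\otimes I\otimes X=I\otimes(I\otimes X)$) such that $(c^k\otimes X)\circ(\delta^k\otimes I\otimes X)=(\delta^k\otimes X)\circ(\varepsilon\otimes X)=(c^k\otimes X)\circ(I\otimes\delta^k\otimes X)$ and $(c^k\otimes X)\circ(\delta^{1-k}\otimes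 I\otimes X)=\mathrm{id}_{I\otimes X}=(c^k\otimes X)\circ(I\otimes\delta^{1-k}\otimes X)$; here $\delta^k\otimes I\otimes X$ is the component at $I\otimes X$, and $I\otimes\delta^k\otimes X$ is $I\otimes(-)$ applied to the component at $X$. For $i\colon A\to B$ the Leibniz product $\delta^k\hat\otimes i\colon (I\otimes A)+_A B\to I\otimes B$ is the map out of the pushout of $\delta^k\otimes A\colon A\to I\otimes A$ and $i\colon A\to B$ induced by $I\otimes i$ and $\delta^k\otimes B$. A weak factorization system (wfs) is cofibrantly generated by a set $\mathcal{I}$ if its right class consists of the maps with the right lifting property against $\mathcal{I}$. A wfs $(\mathsf{Cof},\mathsf{TrivFib})$ is suitable if: (S1) it is cofibrantly generated (by a set); (S2) for every $X\in\mathcal{E}$ the map $0\to X$ is in $\mathsf{Cof}$; (S3) $\mathsf{Cof}$ is closed under pullback along arbitrary maps; (S4) if $i\in\mathsf{Cof}$ then $\delta^k\hat\otimes i\in\mathsf{Cof}$ for $k\in\{0,1\}$. *)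

theory Defs
  imports Main "HOL-Library.FuncSet"
begin

unbundle cardinal_syntax

section \<open>Categories, functors, natural transformations\<close>

record ('o, 'm) cat =
  Obj :: "'o set"
  Arr :: "'m set"
  Dom :: "'m \<Rightarrow> 'o"
  Cod :: "'m \<Rightarrow> 'o"
  Idn :: "'o \<Rightarrow> 'm"
  Cmp :: "'m \<Rightarrow> 'm \<Rightarrow> 'm"  (infixr \<open>\<odot>\<index>\<close> 70)

text \<open>Composition is in function order: \<open>g \<odot>\<^bsub>C\<^esub> f\<close> is \<open>f\<close> followed by \<open>g\<close>.\<close>

definition Hom :: "('o, 'm, 'z) cat_scheme \<Rightarrow> 'o \<Rightarrow> 'o \<Rightarrow> 'm set" where
  "Hom C A B = {f \<in> Arr C. Dom C f = A \<and> Cod C f = B}"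

definition category :: "('o, 'm) cat \<Rightarrow> bool" where
  "category C \<longleftrightarrow>
     (\<forall>f\<in>Arr C. Dom C f \<in> Obj C \<and> Cod C f \<in> Obj C) \<and>
     (\<forall>A\<in>Obj C. Idn C A \<in> Hom C A A) \<and>
     (\<forall>f\<in>Arr C. \<forall>g\<in>Arr C. Cod C f = Dom C g \<longrightarrow>
        g \<odot>\<^bsub>C\<^esub> f \<in> Hom C (Dom C f) (Cod C g)) \<and>
     (\<forall>f\<in>Arr C. f \<odot>\<^bsub>C\<^esub> Idn C (Dom C f) = f \<and> Idn C (Cod C f) \<odot>\<^bsub>C\<^esub> f = f) \<and>
     (\<forall>f\<in>Arr C. \<forall>g\<in>Arr C. \<forall>h\<in>Arr C. Cod C f = Dom C g \<longrightarrow> Cod C g = Dom C h \<longrightarrow>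
        h \<odot>\<^bsub>C\<^esub> (g \<odot>\<^bsub>C\<^esub> f) = (h \<odot>\<^bsub>C\<^esub> g) \<odot>\<^bsub>C\<^esub> f)"

record ('a, 'b, 'c, 'd) cfunctor =
  omap :: "'a \<Rightarrow> 'c"
  amap :: "'b \<Rightarrow> 'd"

definition is_functor ::
  "('a, 'b) cat \<Rightarrow> ('c, 'd) cat \<Rightarrow> ('a, 'b, 'c, 'd) cfunctor \<Rightarrow> bool" where
  "is_functor C D F \<longleftrightarrow>
     (\<forall>A\<in>Obj C. omap F A \<in> Obj D) \<and>
     (\<forall>f\<in>Arr C. amap F f \<in> Hom D (omap F (Dom C f)) (omap F (Cod C f))) \<and>
     (\<forall>A\<in>Obj C. amap F (Idn C A) = Idn D (omap F A)) \<and>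
     (\<forall>f\<in>Arr C. \<forall>g\<in>Arr C. Cod C f = Dom C g \<longrightarrow>
        amap F (g \<odot>\<^bsub>C\<^esub> f) = amap F g \<odot>\<^bsub>D\<^esub> amap F f)"

definition id_functor :: "('a, 'b, 'a, 'b) cfunctor" where
  "id_functor = \<lparr>omap = (\<lambda>A. A), amap = (\<lambda>f. f)\<rparr>"

definition comp_functor ::
  "('c, 'd, 'e, 'f) cfunctor \<Rightarrow> ('a, 'b, 'c, 'd) cfunctor \<Rightarrow> ('a, 'b, 'e, 'f) cfunctor" where
  "comp_functor G F = \<lparr>omap = (\<lambda>A. omap G (omap F A)), amap = (\<lambda>f. amap G (amap F f))\<rparr>"

definition is_nat_trans ::
  "('a, 'b) cat \<Rightarrow> ('c, 'd) cat \<Rightarrow> ('a, 'b, 'c, 'd) cfunctor \<Rightarrow> ('a, 'b, 'c, 'd) cfunctor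
     \<Rightarrow> ('a \<Rightarrow> 'd) \<Rightarrow> bool" where
  "is_nat_trans C D F G t \<longleftrightarrow>
     (\<forall>A\<in>Obj C. t A \<in> Hom D (omap F A) (omap G A)) \<and>
     (\<forall>f\<in>Arr C. t (Cod C f) \<odot>\<^bsub>D\<^esub> amap F f = amap G f \<odot>\<^bsub>D\<^esub> t (Dom C f))"

definition has_right_adjoint ::
  "('a, 'b) cat \<Rightarrow> ('c, 'd) cat \<Rightarrow> ('a, 'b, 'c, 'd) cfunctor \<Rightarrow> bool" where
  "has_right_adjoint C D F \<longleftrightarrow>
     (\<exists>G \<eta> \<epsilon>. is_functor D C G \<and>
        is_nat_trans C C id_functor (comp_functor G F) \<eta> \<and>
        is_nat_trans D D (comp_functor F G) id_functor \<epsilon> \<and>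
        (\<forall>A\<in>Obj C. \<epsilon> (omap F A) \<odot>\<^bsub>D\<^esub> amap F (\<eta> A) = Idn D (omap F A)) \<and>
        (\<forall>B\<in>Obj D. amap G (\<epsilon> B) \<odot>\<^bsub>C\<^esub> \<eta> (omap G B) = Idn C (omap G B)))"


section \<open>Universal constructions\<close>

definition is_initial :: "('o, 'm) cat \<Rightarrow> 'o \<Rightarrow> bool" where
  "is_initial C Z \<longleftrightarrow> Z \<in> Obj C \<and> (\<forall>X\<in>Obj C. \<exists>!f. f \<in> Hom C Z X)"

definition is_terminal :: "('o, 'm) cat \<Rightarrow> 'o \<Rightarrow> bool" where
  "is_terminal C T \<longleftrightarrow> T \<in> Obj C \<and> (\<forall>X\<in>Obj C. \<exists>!f. f \<in> Hom C X T)"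

definition is_product :: "('o, 'm) cat \<Rightarrow> 'o \<Rightarrow> 'o \<Rightarrow> 'o \<Rightarrow> 'm \<Rightarrow> 'm \<Rightarrow> bool" where
  "is_product C A B P p q \<longleftrightarrow>
     P \<in> Obj C \<and> p \<in> Hom C P A \<and> q \<in> Hom C P B \<and>
     (\<forall>Z\<in>Obj C. \<forall>f\<in>Hom C Z A. \<forall>g\<in>Hom C Z B.
        \<exists>!h. h \<in> Hom C Z P \<and> p \<odot>\<^bsub>C\<^esub> h = f \<and> q \<odot>\<^bsub>C\<^esub> h = g)"

definition is_pullback :: "('o, 'm) cat \<Rightarrow> 'm \<Rightarrow> 'm \<Rightarrow> 'm \<Rightarrow> 'm \<Rightarrow> bool" where
  "is_pullback C f g p q \<longleftrightarrow>
     f \<in> Arr C \<and> g \<in> Arr C \<and> p \<in> Arr C \<and> q \<in> Arr C \<and>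
     Cod C f = Cod C g \<and> Dom C p = Dom C q \<and> Cod C p = Dom C f \<and> Cod C q = Dom C g \<and>
     f \<odot>\<^bsub>C\<^esub> p = g \<odot>\<^bsub>C\<^esub> q \<and>
     (\<forall>Z\<in>Obj C. \<forall>u\<in>Hom C Z (Dom C f). \<forall>v\<in>Hom C Z (Dom C g).
        f \<odot>\<^bsub>C\<^esub> u = g \<odot>\<^bsub>C\<^esub> v \<longrightarrow>
        (\<exists>!h. h \<in> Hom C Z (Dom C p) \<and> p \<odot>\<^bsub>C\<^esub> h = u \<and> q \<odot>\<^bsub>C\<^esub> h = v))"

definition is_pushout :: "('o, 'm) cat \<Rightarrow> 'm \<Rightarrow> 'm \<Rightarrow> 'm \<Rightarrow> 'm \<Rightarrow> bool" where
  "is_pushout C f g p q \<longleftrightarrow>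
     f \<in> Arr C \<and> g \<in> Arr C \<and> p \<in> Arr C \<and> q \<in> Arr C \<and>
     Dom C f = Dom C g \<and> Cod C p = Cod C q \<and> Dom C p = Cod C f \<and> Dom C q = Cod C g \<and>
     p \<odot>\<^bsub>C\<^esub> f = q \<odot>\<^bsub>C\<^esub> g \<and>
     (\<forall>Z\<in>Obj C. \<forall>u\<in>Hom C (Cod C f) Z. \<forall>v\<in>Hom C (Cod C g) Z.
        u \<odot>\<^bsub>C\<^esub> f = v \<odot>\<^bsub>C\<^esub> g \<longrightarrow>
        (\<exists>!h. h \<in> Hom C (Cod C p) Z \<and> h \<odot>\<^bsub>C\<^esub> p = u \<and> h \<odot>\<^bsub>C\<^esub> q = v))"

definition is_cocone ::
  "('o, 'm) cat \<Rightarrow> ('j, 'k) cat \<Rightarrow> ('j, 'k, 'o, 'm) cfunctor \<Rightarrow> 'o \<Rightarrow> ('j \<Rightarrow> 'm) \<Rightarrow> bool" where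
  "is_cocone C J D L c \<longleftrightarrow>
     L \<in> Obj C \<and>
     (\<forall>j\<in>Obj J. c j \<in> Hom C (omap D j) L) \<and>
     (\<forall>u\<in>Arr J. c (Cod J u) \<odot>\<^bsub>C\<^esub> amap D u = c (Dom J u))"

definition is_colimit ::
  "('o, 'm) cat \<Rightarrow> ('j, 'k) cat \<Rightarrow> ('j, 'k, 'o, 'm) cfunctor \<Rightarrow> 'o \<Rightarrow> ('j \<Rightarrow> 'm) \<Rightarrow> bool" where
  "is_colimit C J D L c \<longleftrightarrow>
     is_cocone C J D L c \<and>
     (\<forall>M d. is_cocone C J D M d \<longrightarrow>
        (\<exists>!h. h \<in> Hom C L M \<and> (\<forall>j\<in>Obj J. h \<odot>\<^bsub>C\<^esub> c j = d j)))"


section \<open>Locally cartesian closed categories\<close>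

text \<open>An exponential \<open>X = B\<^sup>A\<close> with evaluation \<open>ev\<close> out of a product \<open>(P, p, q)\<close> of \<open>X\<close> and \<open>A\<close>;
  the arrow \<open>h\<close> below is \<open>g \<times> A\<close>.\<close>

definition is_exponential ::
  "('o, 'm) cat \<Rightarrow> 'o \<Rightarrow> 'o \<Rightarrow> 'o \<Rightarrow> 'o \<Rightarrow> 'm \<Rightarrow> 'm \<Rightarrow> 'm \<Rightarrow> bool" where
  "is_exponential C A B X P p q ev \<longleftrightarrow>
     is_product C X A P p q \<and> ev \<in> Hom C P B \<and>
     (\<forall>Z Q r s. \<forall>f\<in>Hom C Q B. is_product C Z A Q r s \<and> Z \<in> Obj C \<longrightarrow>
        (\<exists>!g. g \<in> Hom C Z X \<and>
           (\<exists>h\<in>Hom C Q P. p \<odot>\<^bsub>C\<^esub> h = g \<odot>\<^bsub>C\<^esub> r \<and> q \<odot>\<^bsub>C\<^esub> h = s \<and> ev \<odot>\<^bsub>C\<^esub> h = f)))"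

definition cartesian_closed :: "('o, 'm) cat \<Rightarrow> bool" where
  "cartesian_closed C \<longleftrightarrow>
     (\<exists>T. is_terminal C T) \<and>
     (\<forall>A\<in>Obj C. \<forall>B\<in>Obj C. \<exists>P p q. is_product C A B P p q) \<and>
     (\<forall>A\<in>Obj C. \<forall>B\<in>Obj C. \<exists>X P p q ev. is_exponential C A B X P p q ev)"

text \<open>The slice \<open>C / A\<close>; a triple \<open>(f, h, g)\<close> is the arrow \<open>f \<rightarrow> g\<close> over \<open>A\<close> given by \<open>h\<close>.\<close>

definition slice :: "('o, 'm) cat \<Rightarrow> 'o \<Rightarrow> ('m, 'm \<times> 'm \<times> 'm) cat" where
  "slice C A =
     \<lparr>Obj = {f \<in> Arr C. Cod C f = A},
      Arr = {(f, h, g). f \<in> Arr C \<and> Cod C f = A \<and> g \<in> Arr C \<and> Cod C g = A \<and>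
               h \<in> Hom C (Dom C f) (Dom C g) \<and> g \<odot>\<^bsub>C\<^esub> h = f},
      Dom = (\<lambda>(f, h, g). f),
      Cod = (\<lambda>(f, h, g). g),
      Idn = (\<lambda>f. (f, Idn C (Dom C f), f)),
      Cmp = (\<lambda>(f', h', g') (f, h, g). (f, h' \<odot>\<^bsub>C\<^esub> h, g'))\<rparr>"

definition locally_cartesian_closed :: "('o, 'm) cat \<Rightarrow> bool" where
  "locally_cartesian_closed C \<longleftrightarrow> (\<forall>A\<in>Obj C. cartesian_closed (slice C A))"

lemma category_slice:
  assumes "category C"
  shows "category (slice C A)"
proof -
  have id: "\<And>B. B \<in> Obj C \<Longrightarrow> Idn C B \<in> Hom C B B"
    and ob: "\<And>f. f \<in> Arr C \<Longrightarrow> Dom C f \<in> Obj C \<and> Cod C f \<in> Obj C"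
    and cmp: "\<And>f g. f \<in> Arr C \<Longrightarrow> g \<in> Arr C \<Longrightarrow> Cod C f = Dom C g \<Longrightarrow>
           g \<odot>\<^bsub>C\<^esub> f \<in> Hom C (Dom C f) (Cod C g)"
    and unit: "\<And>f. f \<in> Arr C \<Longrightarrow> f \<odot>\<^bsub>C\<^esub> Idn C (Dom C f) = f \<and> Idn C (Cod C f) \<odot>\<^bsub>C\<^esub> f = f"
    and assoc: "\<And>f g h. f \<in> Arr C \<Longrightarrow> g \<in> Arr C \<Longrightarrow> h \<in> Arr C \<Longrightarrow> Cod C f = Dom C g \<Longrightarrow>
           Cod C g = Dom C h \<Longrightarrow> h \<odot>\<^bsub>C\<^esub> (g \<odot>\<^bsub>C\<^esub> f) = (h \<odot>\<^bsub>C\<^esub> g) \<odot>\<^bsub>C\<^esub> f"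
    using assms unfolding category_def by blast+
  have over: "g' \<odot>\<^bsub>C\<^esub> (h' \<odot>\<^bsub>C\<^esub> h) = f"
    if "g' \<in> Arr C" "h' \<in> Arr C" "h \<in> Arr C" "Cod C h = Dom C h'" "Cod C h' = Dom C g'"
      "g' \<odot>\<^bsub>C\<^esub> h' = g" "g \<odot>\<^bsub>C\<^esub> h = f" for f g g' h h'
    using assoc[OF that(3,2,1,4,5)] that(6,7) by metis
  show ?thesis
    unfolding category_def
  proof (intro conjI ballI impI)
    fix x assume "x \<in> Obj (slice C A)"
    then show "Idn (slice C A) x \<in> Hom (slice C A) x x"
      using id[of "Dom C x"] ob[of x] unit[of x] by (simp add: slice_def Hom_def)
  next
    fix x y assume "x \<in> Arr (slice C A)" "y \<in> Arr (slice C A)"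
      and "Cod (slice C A) x = Dom (slice C A) y"
    then obtain f h g h' g' where xy: "x = (f, h, g)" "y = (g, h', g')"
      and mem: "f \<in> Arr C" "Cod C f = A" "g' \<in> Arr C" "Cod C g' = A"
        "h \<in> Arr C" "Dom C h = Dom C f" "Cod C h = Dom C g" "g \<odot>\<^bsub>C\<^esub> h = f"
        "h' \<in> Arr C" "Dom C h' = Dom C g" "Cod C h' = Dom C g'" "g' \<odot>\<^bsub>C\<^esub> h' = g"
      by (cases x, cases y) (simp add: slice_def Hom_def)
    have "h' \<odot>\<^bsub>C\<^esub> h \<in> Hom C (Dom C f) (Dom C g')"
      using cmp[of h h'] mem by simp
    moreover have "g' \<odot>\<^bsub>C\<^esub> (h' \<odot>\<^bsub>C\<^esub> h) = f"
      using over[of g' h' h g f] mem by simp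
    ultimately show "y \<odot>\<^bsub>slice C A\<^esub> x
        \<in> Hom (slice C A) (Dom (slice C A) x) (Cod (slice C A) y)"
      using mem(1-4) by (simp add: xy slice_def Hom_def)
  next
    fix x assume "x \<in> Arr (slice C A)"
    then obtain f h g where "x = (f, h, g)" "h \<in> Arr C" "Dom C h = Dom C f" "Cod C h = Dom C g"
      by (cases x) (simp add: slice_def Hom_def)
    then show "x \<odot>\<^bsub>slice C A\<^esub> Idn (slice C A) (Dom (slice C A) x) = x"
      and "Idn (slice C A) (Cod (slice C A) x) \<odot>\<^bsub>slice C A\<^esub> x = x"
      using unit[of h] by (simp_all add: slice_def)
  next
    fix x y z assume "x \<in> Arr (slice C A)" "y \<in> Arr (slice C A)" "z \<in> Arr (slice C A)"
      and "Cod (slice C A) x = Dom (slice C A) y" "Cod (slice C A) y = Dom (slice C A) z"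
    then show "z \<odot>\<^bsub>slice C A\<^esub> (y \<odot>\<^bsub>slice C A\<^esub> x) = (z \<odot>\<^bsub>slice C A\<^esub> y) \<odot>\<^bsub>slice C A\<^esub> x"
      using assoc[of "fst (snd x)" "fst (snd y)" "fst (snd z)"]
      by (cases x, cases y, cases z) (simp add: slice_def Hom_def)
  qed (auto simp: slice_def)
qed


section \<open>Smallness and locally presentable categories\<close>

text \<open>Size is measured by a strongly inaccessible cardinal \<open>\<kappa>\<close> (a Grothendieck universe): a set is
  small if it has fewer than \<open>\<kappa>\<close> elements. Every small set is in bijection with a subset of
  the type \<open>'u\<close> on which \<open>\<kappa>\<close> lives, so that up to isomorphism all small index categories and
  all small sets are found there.\<close>

definition inaccessible :: "'u rel \<Rightarrow> bool" where
  "inaccessible \<kappa> \<longleftrightarrow>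
     Card_order \<kappa> \<and> natLeq <o \<kappa> \<and> regularCard \<kappa> \<and>
     (\<forall>A :: 'u set. |A| <o \<kappa> \<longrightarrow> |Pow A| <o \<kappa>)"

definition small :: "'u rel \<Rightarrow> 'a set \<Rightarrow> bool" where
  "small \<kappa> A \<longleftrightarrow> |A| <o \<kappa>"

definition locally_small :: "'u rel \<Rightarrow> ('o, 'm) cat \<Rightarrow> bool" where
  "locally_small \<kappa> C \<longleftrightarrow> (\<forall>A\<in>Obj C. \<forall>B\<in>Obj C. small \<kappa> (Hom C A B))"

definition cocomplete :: "'u rel \<Rightarrow> ('o, 'm) cat \<Rightarrow> bool" where
  "cocomplete \<kappa> C \<longleftrightarrow>
     (\<forall>(J :: ('u, 'u) cat) D. category J \<and> small \<kappa> (Obj J) \<and> small \<kappa> (Arr J) \<and> is_functor J C D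
        \<longrightarrow> (\<exists>L c. is_colimit C J D L c))"

definition poset_cat :: "'p set \<Rightarrow> 'p rel \<Rightarrow> ('p, 'p \<times> 'p) cat" where
  "poset_cat P r =
     \<lparr>Obj = P, Arr = r, Dom = fst, Cod = snd, Idn = (\<lambda>i. (i, i)),
      Cmp = (\<lambda>v u. (fst u, snd v))\<rparr>"

lemma category_poset_cat: "partial_order_on P r \<Longrightarrow> category (poset_cat P r)"
  unfolding partial_order_on_def preorder_on_def refl_on_def category_def poset_cat_def Hom_def
  by (auto dest: transD)

definition regular_cardinal :: "'l rel \<Rightarrow> bool" where
  "regular_cardinal \<mu> \<longleftrightarrow> Cinfinite \<mu> \<and> regularCard \<mu>"

definition directed_poset :: "'l rel \<Rightarrow> 'p set \<Rightarrow> 'p rel \<Rightarrow> bool" where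
  "directed_poset \<mu> P r \<longleftrightarrow>
     partial_order_on P r \<and> (\<forall>S\<subseteq>P. |S| <o \<mu> \<longrightarrow> (\<exists>b\<in>P. \<forall>a\<in>S. (a, b) \<in> r))"

text \<open>The cocone \<open>hom(K, c)\<close> exhibits \<open>hom(K, L)\<close> as the colimit of \<open>hom(K, D -)\<close> in the category
  of small sets.\<close>

definition hom_preserves_colimit ::
  "'u rel \<Rightarrow> ('o, 'm) cat \<Rightarrow> 'o \<Rightarrow> ('j, 'k) cat \<Rightarrow> ('j, 'k, 'o, 'm) cfunctor
     \<Rightarrow> 'o \<Rightarrow> ('j \<Rightarrow> 'm) \<Rightarrow> bool" where
  "hom_preserves_colimit \<kappa> C K J D L c \<longleftrightarrow>
     (\<forall>(T :: 'u set) t. small \<kappa> T \<and>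
        (\<forall>j\<in>Obj J. t j \<in> Hom C K (omap D j) \<rightarrow> T) \<and>
        (\<forall>u\<in>Arr J. \<forall>f\<in>Hom C K (omap D (Dom J u)). t (Cod J u) (amap D u \<odot>\<^bsub>C\<^esub> f) = t (Dom J u) f)
        \<longrightarrow> (\<exists>!w. w \<in> Hom C K L \<rightarrow>\<^sub>E T \<and>
               (\<forall>j\<in>Obj J. \<forall>f\<in>Hom C K (omap D j). w (c j \<odot>\<^bsub>C\<^esub> f) = t j f)))"

definition presentable :: "'u rel \<Rightarrow> 'u rel \<Rightarrow> ('o, 'm) cat \<Rightarrow> 'o \<Rightarrow> bool" where
  "presentable \<kappa> \<mu> C K \<longleftrightarrow>
     K \<in> Obj C \<and>
     (\<forall>(P :: 'u set) r D L c.
        directed_poset \<mu> P r \<and> small \<kappa> P \<and> is_functor (poset_cat P r) C D \<and>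
        is_colimit C (poset_cat P r) D L c
        \<longrightarrow> hom_preserves_colimit \<kappa> C K (poset_cat P r) D L c)"

definition locally_presentable :: "'u rel \<Rightarrow> ('o, 'm) cat \<Rightarrow> bool" where
  "locally_presentable \<kappa> C \<longleftrightarrow>
     locally_small \<kappa> C \<and> cocomplete \<kappa> C \<and>
     (\<exists>\<mu> :: 'u rel. regular_cardinal \<mu> \<and> \<mu> <o \<kappa> \<and>
        (\<exists>G. small \<kappa> G \<and> (\<forall>K\<in>G. presentable \<kappa> \<mu> C K) \<and>
           (\<forall>X\<in>Obj C. \<exists>(P :: 'u set) r D c.
              directed_poset \<mu> P r \<and> small \<kappa> P \<and> is_functor (poset_cat P r) C D \<and>
              (\<forall>i\<in>P. omap D i \<in> G) \<and> is_colimit C (poset_cat P r) D X c)))"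


section \<open>Functorial cylinders\<close>

text \<open>The functor \<open>T\<close> is \<open>I \<otimes> (-)\<close>, and \<open>\<delta> k X\<close>, \<open>\<epsilon> X\<close>, \<open>c k X\<close> are the components at \<open>X\<close>.
  Only the indices \<open>k \<in> {0, 1}\<close> matter.\<close>

definition functorial_cylinder ::
  "('o, 'm) cat \<Rightarrow> ('o, 'm, 'o, 'm) cfunctor \<Rightarrow> (nat \<Rightarrow> 'o \<Rightarrow> 'm) \<Rightarrow> bool" where
  "functorial_cylinder E T \<delta> \<longleftrightarrow>
     is_functor E E T \<and> (\<forall>k\<in>{0, 1}. is_nat_trans E E id_functor T (\<delta> k))"

definition cylinder_contractions ::
  "('o, 'm) cat \<Rightarrow> ('o, 'm, 'o, 'm) cfunctor \<Rightarrow> (nat \<Rightarrow> 'o \<Rightarrow> 'm) \<Rightarrow> ('o \<Rightarrow> 'm) \<Rightarrow> bool" where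
  "cylinder_contractions E T \<delta> \<epsilon> \<longleftrightarrow>
     is_nat_trans E E T id_functor \<epsilon> \<and>
     (\<forall>k\<in>{0, 1}. \<forall>X\<in>Obj E. \<epsilon> X \<odot>\<^bsub>E\<^esub> \<delta> k X = Idn E X)"

definition cylinder_connections ::
  "('o, 'm) cat \<Rightarrow> ('o, 'm, 'o, 'm) cfunctor \<Rightarrow> (nat \<Rightarrow> 'o \<Rightarrow> 'm) \<Rightarrow> ('o \<Rightarrow> 'm)
     \<Rightarrow> (nat \<Rightarrow> 'o \<Rightarrow> 'm) \<Rightarrow> bool" where
  "cylinder_connections E T \<delta> \<epsilon> c \<longleftrightarrow>
     (\<forall>k\<in>{0, 1}. is_nat_trans E E (comp_functor T T) T (c k) \<and>
        (\<forall>X\<in>Obj E.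
           c k X \<odot>\<^bsub>E\<^esub> \<delta> k (omap T X) = \<delta> k X \<odot>\<^bsub>E\<^esub> \<epsilon> X \<and>
           c k X \<odot>\<^bsub>E\<^esub> amap T (\<delta> k X) = \<delta> k X \<odot>\<^bsub>E\<^esub> \<epsilon> X \<and>
           c k X \<odot>\<^bsub>E\<^esub> \<delta> (1 - k) (omap T X) = Idn E (omap T X) \<and>
           c k X \<odot>\<^bsub>E\<^esub> amap T (\<delta> (1 - k) X) = Idn E (omap T X)))"

text \<open>Pushouts are determined only up to isomorphism; one of them is chosen once and for all. The
  result consists of the two coprojections.\<close>

definition pushout :: "('o, 'm) cat \<Rightarrow> 'm \<Rightarrow> 'm \<Rightarrow> 'm \<times> 'm" where
  "pushout C f g = (SOME pq. is_pushout C f g (fst pq) (snd pq))"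

definition leibniz ::
  "('o, 'm) cat \<Rightarrow> ('o, 'm, 'o, 'm) cfunctor \<Rightarrow> (nat \<Rightarrow> 'o \<Rightarrow> 'm) \<Rightarrow> nat \<Rightarrow> 'm \<Rightarrow> 'm" where
  "leibniz E T \<delta> k i =
     (let (p, q) = pushout E (\<delta> k (Dom E i)) i in
        THE h. h \<in> Hom E (Cod E p) (omap T (Cod E i)) \<and>
               h \<odot>\<^bsub>E\<^esub> p = amap T i \<and> h \<odot>\<^bsub>E\<^esub> q = \<delta> k (Cod E i))"

lemma leibniz_spec:
  assumes cat: "category E" and cyl: "functorial_cylinder E T \<delta>" and k: "k \<in> {0, 1}"
    and i: "i \<in> Arr E" and ex: "\<exists>p q. is_pushout E (\<delta> k (Dom E i)) i p q"
  obtains p q where "is_pushout E (\<delta> k (Dom E i)) i p q"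
    "leibniz E T \<delta> k i \<in> Hom E (Cod E p) (omap T (Cod E i))"
    "leibniz E T \<delta> k i \<odot>\<^bsub>E\<^esub> p = amap T i"
    "leibniz E T \<delta> k i \<odot>\<^bsub>E\<^esub> q = \<delta> k (Cod E i)"
proof -
  obtain p q where pq: "pushout E (\<delta> k (Dom E i)) i = (p, q)"
    by fastforce
  have "\<exists>pq. is_pushout E (\<delta> k (Dom E i)) i (fst pq) (snd pq)"
    using ex by auto
  then have po: "is_pushout E (\<delta> k (Dom E i)) i p q"
    using someI_ex[of "\<lambda>pq. is_pushout E (\<delta> k (Dom E i)) i (fst pq) (snd pq)"] pq
    unfolding pushout_def by simp
  have T: "is_functor E E T" and nat: "is_nat_trans E E id_functor T (\<delta> k)"
    using cyl k unfolding functorial_cylinder_def by blast+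
  have obj: "Dom E i \<in> Obj E" "Cod E i \<in> Obj E"
    using cat i unfolding category_def by auto
  have TB: "omap T (Cod E i) \<in> Obj E"
    using T obj unfolding is_functor_def by auto
  have dA: "Cod E (\<delta> k (Dom E i)) = omap T (Dom E i)"
    and dB: "\<delta> k (Cod E i) \<in> Hom E (Cod E i) (omap T (Cod E i))"
    using nat obj unfolding is_nat_trans_def id_functor_def Hom_def by auto
  have Ti: "amap T i \<in> Hom E (Cod E (\<delta> k (Dom E i))) (omap T (Cod E i))"
    using T i dA unfolding is_functor_def by auto
  have comm: "amap T i \<odot>\<^bsub>E\<^esub> \<delta> k (Dom E i) = \<delta> k (Cod E i) \<odot>\<^bsub>E\<^esub> i"
    using nat i unfolding is_nat_trans_def id_functor_def by auto
  have "\<exists>!h. h \<in> Hom E (Cod E p) (omap T (Cod E i)) \<and>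
          h \<odot>\<^bsub>E\<^esub> p = amap T i \<and> h \<odot>\<^bsub>E\<^esub> q = \<delta> k (Cod E i)"
    using po TB Ti dB comm unfolding is_pushout_def by blast
  from theI'[OF this]
  show ?thesis
    using that[OF po] unfolding leibniz_def pq by simp
qed


section \<open>Weak factorization systems\<close>

definition lifts :: "('o, 'm) cat \<Rightarrow> 'm \<Rightarrow> 'm \<Rightarrow> bool" where
  "lifts E f g \<longleftrightarrow>
     (\<forall>u\<in>Hom E (Dom E f) (Dom E g). \<forall>v\<in>Hom E (Cod E f) (Cod E g).
        g \<odot>\<^bsub>E\<^esub> u = v \<odot>\<^bsub>E\<^esub> f \<longrightarrow>
        (\<exists>h\<in>Hom E (Cod E f) (Dom E g). h \<odot>\<^bsub>E\<^esub> f = u \<and> g \<odot>\<^bsub>E\<^esub> h = v))"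

definition llp :: "('o, 'm) cat \<Rightarrow> 'm set \<Rightarrow> 'm set" where
  "llp E S = {f \<in> Arr E. \<forall>g\<in>S. lifts E f g}"

definition rlp :: "('o, 'm) cat \<Rightarrow> 'm set \<Rightarrow> 'm set" where
  "rlp E S = {g \<in> Arr E. \<forall>f\<in>S. lifts E f g}"

definition wfs :: "('o, 'm) cat \<Rightarrow> 'm set \<Rightarrow> 'm set \<Rightarrow> bool" where
  "wfs E L R \<longleftrightarrow>
     L = llp E R \<and> R = rlp E L \<and>
     (\<forall>f\<in>Arr E. \<exists>l\<in>L. \<exists>r\<in>R. Cod E l = Dom E r \<and> r \<odot>\<^bsub>E\<^esub> l = f)"

definition cofibrantly_generated_by ::
  "'u rel \<Rightarrow> ('o, 'm) cat \<Rightarrow> 'm set \<Rightarrow> 'm set \<Rightarrow> 'm set \<Rightarrow> bool" where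
  "cofibrantly_generated_by \<kappa> E L R S \<longleftrightarrow>
     wfs E L R \<and> S \<subseteq> Arr E \<and> small \<kappa> S \<and> R = rlp E S"

definition suitable_wfs ::
  "'u rel \<Rightarrow> ('o, 'm) cat \<Rightarrow> ('o, 'm, 'o, 'm) cfunctor \<Rightarrow> (nat \<Rightarrow> 'o \<Rightarrow> 'm)
     \<Rightarrow> 'm set \<Rightarrow> 'm set \<Rightarrow> bool" where
  "suitable_wfs \<kappa> E T \<delta> Cof TrivFib \<longleftrightarrow>
     wfs E Cof TrivFib \<and>
     (\<exists>S. cofibrantly_generated_by \<kappa> E Cof TrivFib S) \<and>
     (\<forall>Z X f. is_initial E Z \<and> X \<in> Obj E \<and> f \<in> Hom E Z X \<longrightarrow> f \<in> Cof) \<and>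
     (\<forall>i\<in>Cof. \<forall>f p q. is_pullback E i f p q \<longrightarrow> q \<in> Cof) \<and>
     (\<forall>i\<in>Cof. \<forall>k\<in>{0, 1}. leibniz E T \<delta> k i \<in> Cof)"

definition leibniz_generators ::
  "('o, 'm) cat \<Rightarrow> ('o, 'm, 'o, 'm) cfunctor \<Rightarrow> (nat \<Rightarrow> 'o \<Rightarrow> 'm) \<Rightarrow> 'm set \<Rightarrow> 'm set" where
  "leibniz_generators E T \<delta> S = {leibniz E T \<delta> k i | k i. k \<in> {0, 1} \<and> i \<in> S}"

end

theory Submission
  imports Defs
begin

text \<open>
  The Leibniz products of the generators with the two endpoints form a small set of arrows, and
  every small set \<open>S\<close> of arrows in a locally presentable category generates a weak factorization
  system whose right class is \<open>rlp E S\<close> and whose left class is \<open>llp E (rlp E S)\<close>. This is Quillen's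
  small object argument. That the two classes determine each other is a formal property of the
  Galois connection between \<open>llp\<close> and \<open>rlp\<close>; the content is the factorization of an arbitrary
  arrow \<open>f : X \<rightarrow> Y\<close>.

  To factor \<open>f\<close>, one builds a transfinite tower of objects over \<open>Y\<close>, indexed by a regular cardinal
  \<open>\<theta>\<close>. Stage \<open>a\<close> is a single colimit, which glues together \<open>X\<close>, all earlier stages, and
  one new cell for every commutative square from an arrow of \<open>S\<close> to the projection of an
  earlier stage to \<open>Y\<close>. Let \<open>L\<close> be the colimit of the whole tower. A lifting problem for the map
  from \<open>X\<close> to \<open>L\<close> against an arrow of \<open>rlp E S\<close> is solved by transfinite recursion: a lift on all
  earlier stages extends to stage \<open>a\<close>, because each new cell can be lifted separately
  (\<open>lift_extends_to_stage\<close>, \<open>base_map_has_llp\<close>). A lifting problem of \<open>i \<in> S\<close> against the map from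
  \<open>L\<close> to \<open>Y\<close> is solved by a cell, as soon as the arrow from the domain of \<open>i\<close> to \<open>L\<close> factors through
  some stage \<open>b\<close>: every stage after \<open>b\<close> contains a cell for the resulting square
  (\<open>projection_has_rlp\<close>).

  It remains to choose \<open>\<theta>\<close> so long that such factorizations exist (\<open>common_chain_length\<close>). An object \<open>A\<close>
  is a small \<open>\<mu>\<close>-directed colimit of \<open>\<mu>\<close>-presentable objects. An arrow from \<open>A\<close> to the colimit of a
  chain of length \<open>\<theta> \<ge> \<mu>\<close> restricts to arrows from these presentable objects, each of which factors
  through some stage, and each relation between two of them already holds at some stage. If there
  are fewer than \<open>\<theta>\<close> of these stages, then they have an upper bound, and \<open>A\<close> maps to that stage
  (\<open>small_for_long_chains\<close>). A small set of objects has a common such \<open>\<theta>\<close> below the inaccessible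
  cardinal, and hence the tower is a small diagram and has a colimit.
\<close>

section \<open>Arithmetic of small sets\<close>

locale universe =
  fixes \<kappa> :: "'u rel"
  assumes inaccessible: "inaccessible \<kappa>"
begin

lemma Card_order_universe: "Card_order \<kappa>"
  using inaccessible unfolding inaccessible_def by blast

lemma Cinfinite_universe: "Cinfinite \<kappa>"
proof -
  have "natLeq \<le>o \<kappa>"
    using inaccessible by (simp add: inaccessible_def ordLess_imp_ordLeq)
  then show ?thesis
    using cinfinite_mono[OF _ natLeq_cinfinite] Card_order_universe by simp
qed

lemma stable_universe: "stable \<kappa>"
  using regularCard_stable[of \<kappa>] Cinfinite_universe inaccessible
  by (simp add: inaccessible_def cinfinite_def)

lemma small_if_inj_on: "inj_on f A \<Longrightarrow> f ` A \<subseteq> B \<Longrightarrow> small \<kappa> B \<Longrightarrow> small \<kappa> A"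
  unfolding small_def
  by (metis card_of_ordLeq ordLeq_ordLess_trans)

lemma small_subset: "A \<subseteq> B \<Longrightarrow> small \<kappa> B \<Longrightarrow> small \<kappa> A"
  unfolding small_def by (rule ordLeq_ordLess_trans[OF card_of_mono1])

lemma small_image: "small \<kappa> A \<Longrightarrow> small \<kappa> (f ` A)"
  unfolding small_def by (rule ordLeq_ordLess_trans[OF card_of_image])

lemma small_nat: "small \<kappa> (UNIV :: nat set)"
  using inaccessible by (auto simp: small_def inaccessible_def intro: ordIso_ordLess_trans[OF card_of_nat])

lemma small_finite: "finite A \<Longrightarrow> small \<kappa> A"
  using finite_imp_inj_to_nat_seg[of A] small_if_inj_on[OF _ subset_UNIV small_nat] by metis

lemma small_Sigma: "small \<kappa> A \<Longrightarrow> (\<And>a. a \<in> A \<Longrightarrow> small \<kappa> (F a)) \<Longrightarrow> small \<kappa> (Sigma A F)"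
  unfolding small_def by (rule stable_elim[OF stable_universe])

lemma small_UN: "small \<kappa> A \<Longrightarrow> (\<And>a. a \<in> A \<Longrightarrow> small \<kappa> (F a)) \<Longrightarrow> small \<kappa> (\<Union>a\<in>A. F a)"
  unfolding small_def by (rule stable_UNION[OF stable_universe])

lemma small_Plus: "small \<kappa> A \<Longrightarrow> small \<kappa> B \<Longrightarrow> small \<kappa> (A <+> B)"
  using card_of_Plus_ordLess_infinite_Field[of \<kappa> A B] Cinfinite_universe
  by (simp add: small_def cinfinite_def)

lemma small_Un:
  assumes "small \<kappa> A" "small \<kappa> B"
  shows "small \<kappa> (A \<union> B)"
proof -
  have "small \<kappa> (\<Union>b. if b then A else B)"
    using assms small_finite[of "UNIV :: bool set"] by (intro small_UN) auto
  then show ?thesis by (simp add: UNIV_bool Un_commute)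
qed

lemma small_embeds:
  assumes "small \<kappa> A"
  shows "\<exists>e :: 'a \<Rightarrow> 'u. inj_on e A"
proof -
  have "|A| \<le>o |Field \<kappa>|"
    using assms ordLeq_ordIso_trans[OF ordLess_imp_ordLeq
        ordIso_symmetric[OF card_of_Field_ordIso[OF Card_order_universe]]]
    by (simp add: small_def)
  then show ?thesis
    unfolding card_of_ordLeq[symmetric] by blast
qed

text \<open>
  The successor of an infinite cardinal is regular and is at most the cardinality of a power set, so
  it lies below the inaccessible \<open>\<kappa>\<close>. It is moved to the type \<open>'u\<close>, because presentability tests
  only directed posets that live there.
\<close>

lemma ex_regular_cardinal_above:
  assumes "small \<kappa> X"
  shows "\<exists>\<theta> :: 'u rel. regular_cardinal \<theta> \<and> \<theta> <o \<kappa> \<and> |X| <o \<theta>"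
proof -
  obtain e :: "'a + nat \<Rightarrow> 'u" where e: "inj_on e (X <+> UNIV)"
    using small_embeds[OF small_Plus[OF assms small_nat]] by blast
  \<comment> \<open>The natural numbers are added because only infinite cardinals have regular successors.\<close>
  define Y where "Y = e ` (X <+> UNIV)"
  have Y: "small \<kappa> Y"
    unfolding Y_def by (intro small_image small_Plus assms small_nat)
  have "infinite Y"
    unfolding Y_def using e by (simp add: finite_image_iff)
  then have Yinf: "Cinfinite |Y|"
    unfolding cinfinite_def by (simp add: card_of_card_order_on Field_card_of)
  have XY: "|X| \<le>o |Y|"
    using e by (intro card_of_ordLeqI[of "e \<circ> Inl"]) (auto simp: Y_def inj_on_def)
  have suc: "cardSuc |Y| \<le>o |Pow Y|"
    by (simp only: cardSuc_least card_of_Card_order card_of_Pow)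
  moreover have "|Pow Y| <o \<kappa>"
    using Y inaccessible by (simp add: small_def inaccessible_def)
  ultimately have less: "cardSuc |Y| <o \<kappa>"
    by (rule ordLeq_ordLess_trans)
  have Csuc: "Cinfinite (cardSuc |Y| )" and reg: "regularCard (cardSuc |Y| )"
    using Cinfinite_cardSuc[OF Yinf] regularCard_cardSuc[OF Yinf] by simp_all
  have iso: "|Field (cardSuc |Y| )| =o cardSuc |Y|"
    using Csuc by (simp add: card_of_Field_ordIso)
  then have "small \<kappa> (Field (cardSuc |Y| ))"
    unfolding small_def using less by (rule ordIso_ordLess_trans)
  then obtain d :: "'u set \<Rightarrow> 'u" where "inj_on d (Field (cardSuc |Y| ))"
    using small_embeds by auto
  then have "|Field (cardSuc |Y| )| =o |d ` Field (cardSuc |Y| )|"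
    by (rule card_of_ordIsoI[OF inj_on_imp_bij_betw])
  then have *: "cardSuc |Y| =o |d ` Field (cardSuc |Y| )|" (is "_ =o ?\<theta>")
    by (rule ordIso_transitive[OF ordIso_symmetric[OF iso]])
  have "regular_cardinal ?\<theta>"
    unfolding regular_cardinal_def
    using regularCard_ordIso[OF * Csuc reg] Cinfinite_cong[OF * Csuc] by simp
  moreover have "?\<theta> <o \<kappa>"
    using ordIso_symmetric[OF *] less by (rule ordIso_ordLess_trans)
  moreover have "|X| <o ?\<theta>"
    using ordLeq_ordLess_trans[OF XY ordLess_ordIso_trans[OF cardSuc_greater *]] 
    by (simp only: card_of_Card_order)
  ultimately show ?thesis by blast
qed

end

text \<open>
  The well-order \<open>\<theta>\<close> is linear, so a subset without an upper bound is cofinal, and a cofinal subset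
  of a regular cardinal has full cardinality.
\<close>

lemma regular_cardinal_bounded:
  assumes \<theta>: "regular_cardinal \<theta>" and S: "S \<subseteq> Field \<theta>" "|S| <o \<theta>"
  shows "\<exists>b\<in>Field \<theta>. \<forall>a\<in>S. (a, b) \<in> \<theta>"
proof -
  have "\<not> cofinal S \<theta>"
    using assms not_ordLess_ordIso by (auto simp: regular_cardinal_def regularCard_def)
  then obtain b where b: "b \<in> Field \<theta>" "\<forall>a\<in>S. b = a \<or> (b, a) \<notin> \<theta>"
    unfolding cofinal_def by blast
  have lin: "refl_on (Field \<theta>) \<theta>" "total_on (Field \<theta>) \<theta>"
    using \<theta> unfolding regular_cardinal_def card_order_on_def well_order_on_def
      linear_order_on_def partial_order_on_def preorder_on_def by blast+
  have "(a, b) \<in> \<theta>" if "a \<in> S" for a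
    using that b S(1) lin unfolding refl_on_def total_on_def by (metis subsetD)
  then show ?thesis using b by blast
qed

section \<open>Composition in a category\<close>

locale cat =
  fixes E :: "('o, 'm) cat"
  assumes category: "category E"
begin

lemma Hom_Arr: "f \<in> Hom E A B \<Longrightarrow> f \<in> Arr E"
  by (simp add: Hom_def)

lemma in_Hom: "f \<in> Arr E \<Longrightarrow> f \<in> Hom E (Dom E f) (Cod E f)"
  by (simp add: Hom_def)

lemma Hom_Dom: "f \<in> Hom E A B \<Longrightarrow> Dom E f = A"
  and Hom_Cod: "f \<in> Hom E A B \<Longrightarrow> Cod E f = B"
  by (simp_all add: Hom_def)

lemma Dom_Obj: "f \<in> Arr E \<Longrightarrow> Dom E f \<in> Obj E"
  and Cod_Obj: "f \<in> Arr E \<Longrightarrow> Cod E f \<in> Obj E"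
  using category unfolding category_def by blast+

lemma Hom_Obj: "f \<in> Hom E A B \<Longrightarrow> A \<in> Obj E \<and> B \<in> Obj E"
  using Dom_Obj Cod_Obj by (auto simp: Hom_def)

lemma Idn_Hom: "A \<in> Obj E \<Longrightarrow> Idn E A \<in> Hom E A A"
  using category unfolding category_def by blast

lemma Cmp_Hom: "f \<in> Hom E A B \<Longrightarrow> g \<in> Hom E B C \<Longrightarrow> g \<odot>\<^bsub>E\<^esub> f \<in> Hom E A C"
  using category unfolding category_def Hom_def by auto

lemma Cmp_Idn: "f \<in> Hom E A B \<Longrightarrow> f \<odot>\<^bsub>E\<^esub> Idn E A = f"
  and Idn_Cmp: "f \<in> Hom E A B \<Longrightarrow> Idn E B \<odot>\<^bsub>E\<^esub> f = f"
  using category unfolding category_def Hom_def by auto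

lemma Cmp_assoc:
  "f \<in> Hom E A B \<Longrightarrow> g \<in> Hom E B C \<Longrightarrow> h \<in> Hom E C D
    \<Longrightarrow> (h \<odot>\<^bsub>E\<^esub> g) \<odot>\<^bsub>E\<^esub> f = h \<odot>\<^bsub>E\<^esub> (g \<odot>\<^bsub>E\<^esub> f)"
  using category unfolding category_def Hom_def by auto

end

section \<open>Colimits presented by nodes and relations\<close>

locale cocomplete_cat = universe \<kappa> + cat E
  for \<kappa> :: "'u rel" and E :: "('o, 'm) cat" +
  assumes cocomplete: "cocomplete \<kappa> E"
begin

text \<open>
  Cocompleteness speaks about index categories on the type \<open>'u\<close>; a small index category of any type
  can be copied to \<open>'u\<close> along injections of its objects and its arrows.
\<close>

lemma small_colimit_exists:
  fixes J :: "('a, 'b) cat"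
  assumes J: "category J" and small: "small \<kappa> (Obj J)" "small \<kappa> (Arr J)" and D: "is_functor J E D"
  shows "\<exists>L c. is_colimit E J D L c"
proof -
  obtain eo :: "'a \<Rightarrow> 'u" and ea :: "'b \<Rightarrow> 'u" where inj: "inj_on eo (Obj J)" "inj_on ea (Arr J)"
    using small small_embeds by meson
  define io where "io = inv_into (Obj J) eo"
  define ia where "ia = inv_into (Arr J) ea"
  have io [simp]: "x \<in> Obj J \<Longrightarrow> io (eo x) = x" for x
    unfolding io_def using inj by simp
  have ia [simp]: "x \<in> Arr J \<Longrightarrow> ia (ea x) = x" for x
    unfolding ia_def using inj by simp
  define J' :: "('u, 'u) cat" where "J' =
    \<lparr>Obj = eo ` Obj J, Arr = ea ` Arr J, Dom = (\<lambda>x. eo (Dom J (ia x))),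
     Cod = (\<lambda>x. eo (Cod J (ia x))), Idn = (\<lambda>x. ea (Idn J (io x))),
     Cmp = (\<lambda>y x. ea (ia y \<odot>\<^bsub>J\<^esub> ia x))\<rparr>"
  define D' where "D' = \<lparr>omap = (\<lambda>x. omap D (io x)), amap = (\<lambda>x. amap D (ia x))\<rparr>"
  interpret J: cat J by unfold_locales (rule J)
  have eo_eq [simp]: "x \<in> Obj J \<Longrightarrow> y \<in> Obj J \<Longrightarrow> eo x = eo y \<longleftrightarrow> x = y" for x y
    using inj by (simp add: inj_on_eq_iff)
  note [simp] = J.Dom_Obj J.Cod_Obj
  have id_J: "Idn J x \<in> Arr J" "Dom J (Idn J x) = x" "Cod J (Idn J x) = x" if "x \<in> Obj J" for x
    using J.Idn_Hom[OF that] by (auto simp: Hom_def)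
  have cmp_J: "g \<odot>\<^bsub>J\<^esub> f \<in> Arr J" "Dom J (g \<odot>\<^bsub>J\<^esub> f) = Dom J f" "Cod J (g \<odot>\<^bsub>J\<^esub> f) = Cod J g"
    if "f \<in> Arr J" "g \<in> Arr J" "Cod J f = Dom J g" for f g
    using J.Cmp_Hom[of f "Dom J f" "Cod J f" g "Cod J g"] that by (auto simp: Hom_def)
  note [simp] = id_J cmp_J
  have unit_J: "f \<odot>\<^bsub>J\<^esub> Idn J (Dom J f) = f" "Idn J (Cod J f) \<odot>\<^bsub>J\<^esub> f = f" if "f \<in> Arr J" for f
    using J.Cmp_Idn J.Idn_Cmp J.in_Hom that by blast+
  have "category J'"
    unfolding category_def
  proof (intro conjI ballI impI)
    fix f g h assume "f \<in> Arr J'" "g \<in> Arr J'" "h \<in> Arr J'"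
      and c: "Cod J' f = Dom J' g" "Cod J' g = Dom J' h"
    then obtain u v w where "f = ea u" "g = ea v" "h = ea w"
        "u \<in> Arr J" "v \<in> Arr J" "w \<in> Arr J"
      by (auto simp: J'_def)
    with c show "h \<odot>\<^bsub>J'\<^esub> g \<odot>\<^bsub>J'\<^esub> f = (h \<odot>\<^bsub>J'\<^esub> g) \<odot>\<^bsub>J'\<^esub> f"
      using J.Cmp_assoc[of u "Dom J u" "Dom J v" v "Dom J w" w "Cod J w"]
      by (simp add: J'_def Hom_def)
  qed (auto simp: J'_def Hom_def unit_J)
  moreover have "small \<kappa> (Obj J')" "small \<kappa> (Arr J')"
    using small small_image by (auto simp: J'_def)
  moreover have "is_functor J' E D'"
    using D unfolding is_functor_def by (auto simp: J'_def D'_def)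
  ultimately obtain L c where L: "is_colimit E J' D' L c"
    using cocomplete unfolding cocomplete_def by blast
  have cocone: "is_cocone E J' D' M d \<longleftrightarrow> is_cocone E J D M (\<lambda>j. d (eo j))" for M d
    unfolding is_cocone_def by (auto simp: J'_def D'_def)
  have "is_colimit E J D L (\<lambda>j. c (eo j))"
    unfolding is_colimit_def
  proof (intro conjI allI impI)
    show "is_cocone E J D L (\<lambda>j. c (eo j))"
      using L cocone unfolding is_colimit_def by blast
    fix M d assume "is_cocone E J D M d"
    then have "is_cocone E J' D' M (\<lambda>x. d (io x))"
      unfolding is_cocone_def by (auto simp: J'_def D'_def)
    then have "\<exists>!h. h \<in> Hom E L M \<and> (\<forall>j\<in>Obj J'. h \<odot>\<^bsub>E\<^esub> c j = d (io j))"
      using L unfolding is_colimit_def by blast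
    then show "\<exists>!h. h \<in> Hom E L M \<and> (\<forall>j\<in>Obj J. h \<odot>\<^bsub>E\<^esub> c (eo j) = d j)"
      by (simp add: J'_def)
  qed
  then show ?thesis by blast
qed

end

text \<open>
  A colimit is presented by a family \<open>D\<close> of objects, indexed by a set \<open>N\<close> of nodes, and a set of
  relations. The relation \<open>(n, f, n', f')\<close> demands that the coprojections of the nodes \<open>n\<close> and \<open>n'\<close>
  agree after composition with \<open>f\<close> and \<open>f'\<close>, two arrows with the same domain. Pushouts and the
  stages of the tower below are of this form. In contrast to a functor on an index category, such a
  presentation carries no composition laws to be checked.
\<close>

definition glue_diagram ::
  "('o, 'm) cat \<Rightarrow> 'n set \<Rightarrow> ('n \<Rightarrow> 'o) \<Rightarrow> ('n \<times> 'm \<times> 'n \<times> 'm) set \<Rightarrow> bool" where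
  "glue_diagram E N D R \<longleftrightarrow>
     (\<forall>n\<in>N. D n \<in> Obj E) \<and>
     (\<forall>(n, f, n', f')\<in>R. n \<in> N \<and> n' \<in> N \<and> (\<exists>K. f \<in> Hom E K (D n) \<and> f' \<in> Hom E K (D n')))"

definition glue_cocone ::
  "('o, 'm) cat \<Rightarrow> 'n set \<Rightarrow> ('n \<Rightarrow> 'o) \<Rightarrow> ('n \<times> 'm \<times> 'n \<times> 'm) set \<Rightarrow> 'o \<Rightarrow> ('n \<Rightarrow> 'm) \<Rightarrow> bool"
  where
  "glue_cocone E N D R L c \<longleftrightarrow>
     L \<in> Obj E \<and> (\<forall>n\<in>N. c n \<in> Hom E (D n) L) \<and>
     (\<forall>(n, f, n', f')\<in>R. c n \<odot>\<^bsub>E\<^esub> f = c n' \<odot>\<^bsub>E\<^esub> f')"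

definition is_glue ::
  "('o, 'm) cat \<Rightarrow> 'n set \<Rightarrow> ('n \<Rightarrow> 'o) \<Rightarrow> ('n \<times> 'm \<times> 'n \<times> 'm) set \<Rightarrow> 'o \<Rightarrow> ('n \<Rightarrow> 'm) \<Rightarrow> bool"
  where
  "is_glue E N D R L c \<longleftrightarrow>
     glue_cocone E N D R L c \<and>
     (\<forall>M d. glue_cocone E N D R M d \<longrightarrow>
        (\<exists>!h. h \<in> Hom E L M \<and> (\<forall>n\<in>N. h \<odot>\<^bsub>E\<^esub> c n = d n)))"

lemma is_glue_cong:
  assumes "\<And>n. n \<in> N \<Longrightarrow> D n = D' n"
  shows "is_glue E N D R L c \<longleftrightarrow> is_glue E N D' R L c"
  using assms unfolding is_glue_def glue_cocone_def by simp

lemma is_glue_cocone: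
  assumes "is_glue E N D R L c"
  shows "L \<in> Obj E" "n \<in> N \<Longrightarrow> c n \<in> Hom E (D n) L"
    "(n, g, n', g') \<in> R \<Longrightarrow> c n \<odot>\<^bsub>E\<^esub> g = c n' \<odot>\<^bsub>E\<^esub> g'"
  using assms unfolding is_glue_def glue_cocone_def by auto

lemma is_glue_induce:
  assumes "is_glue E N D R L c" "glue_cocone E N D R M d"
  obtains h where "h \<in> Hom E L M" "\<And>n. n \<in> N \<Longrightarrow> h \<odot>\<^bsub>E\<^esub> c n = d n"
  using assms unfolding is_glue_def by blast

lemma (in cat) is_glue_unique:
  assumes g: "is_glue E N D R L c" and h: "h \<in> Hom E L M" "h' \<in> Hom E L M"
    and eq: "\<And>n. n \<in> N \<Longrightarrow> h \<odot>\<^bsub>E\<^esub> c n = h' \<odot>\<^bsub>E\<^esub> c n"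
    and R: "glue_diagram E N D R"
  shows "h = h'"
proof -
  have c: "\<And>n. n \<in> N \<Longrightarrow> c n \<in> Hom E (D n) L"
    and rel: "\<And>n f n' f'. (n, f, n', f') \<in> R \<Longrightarrow> c n \<odot>\<^bsub>E\<^esub> f = c n' \<odot>\<^bsub>E\<^esub> f'"
    using g unfolding is_glue_def glue_cocone_def by auto
  have "glue_cocone E N D R M (\<lambda>n. h \<odot>\<^bsub>E\<^esub> c n)"
    unfolding glue_cocone_def
  proof (intro conjI ballI; clarify?)
    show "M \<in> Obj E" using h Hom_Obj by blast
    show "h \<odot>\<^bsub>E\<^esub> c n \<in> Hom E (D n) M" if "n \<in> N" for n
      using that Cmp_Hom c h by blast
    fix n f n' f' assume r: "(n, f, n', f') \<in> R"
    then obtain K where nf: "n \<in> N" "n' \<in> N" "f \<in> Hom E K (D n)" "f' \<in> Hom E K (D n')"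
      using R unfolding glue_diagram_def by blast
    show "(h \<odot>\<^bsub>E\<^esub> c n) \<odot>\<^bsub>E\<^esub> f = (h \<odot>\<^bsub>E\<^esub> c n') \<odot>\<^bsub>E\<^esub> f'"
      using rel[OF r] Cmp_assoc[OF nf(3) c[OF nf(1)] h(1)] Cmp_assoc[OF nf(4) c[OF nf(2)] h(1)]
      by simp
  qed
  then have "\<exists>!k. k \<in> Hom E L M \<and> (\<forall>n\<in>N. k \<odot>\<^bsub>E\<^esub> c n = h \<odot>\<^bsub>E\<^esub> c n)"
    using g unfolding is_glue_def by blast
  then show ?thesis using h eq by metis
qed

text \<open>
  The index category is bipartite: it has an object for each node and for each relation, and two
  arrows from each relation to the nodes that it compares. No two of the latter arrows are
  composable, so every diagram of this shape is a functor.
\<close>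

lemma (in cocomplete_cat) glue_exists:
  fixes N :: "'n set" and R :: "('n \<times> 'm \<times> 'n \<times> 'm) set"
  assumes N: "small \<kappa> N" and R: "small \<kappa> R" and diag: "glue_diagram E N D R"
  shows "\<exists>L c. is_glue E N D R L c"
proof -
  define src :: "('n \<times> 'm \<times> 'n \<times> 'm) \<times> bool \<Rightarrow> 'n"
    where "src = (\<lambda>(r, b). if b then fst r else fst (snd (snd r)))"
  define leg :: "('n \<times> 'm \<times> 'n \<times> 'm) \<times> bool \<Rightarrow> 'm"
    where "leg = (\<lambda>(r, b). if b then fst (snd r) else snd (snd (snd r)))"
  \<comment> \<open>The arrow \<open>Inl x\<close> is the identity of \<open>x\<close>, and \<open>Inr (r, b)\<close> is one of the two legs of \<open>r\<close>. If
    the first of two composable arrows is a leg, then the second one is an identity.\<close>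
  define J :: "('n + 'n \<times> 'm \<times> 'n \<times> 'm,
      ('n + 'n \<times> 'm \<times> 'n \<times> 'm) + ('n \<times> 'm \<times> 'n \<times> 'm) \<times> bool) cat"
    where "J = \<lparr>Obj = N <+> R, Arr = (N <+> R) <+> (R \<times> UNIV),
      Dom = case_sum id (\<lambda>e. Inr (fst e)), Cod = case_sum id (\<lambda>e. Inl (src e)),
      Idn = Inl, Cmp = (\<lambda>g f. case f of Inl _ \<Rightarrow> g | Inr _ \<Rightarrow> f)\<rparr>"
  define F :: "('n + 'n \<times> 'm \<times> 'n \<times> 'm,
      ('n + 'n \<times> 'm \<times> 'n \<times> 'm) + ('n \<times> 'm \<times> 'n \<times> 'm) \<times> bool, 'o, 'm) cfunctor"
    where "F = \<lparr>omap = case_sum D (\<lambda>r. Dom E (fst (snd r))),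
      amap = case_sum (case_sum (\<lambda>n. Idn E (D n)) (\<lambda>r. Idn E (Dom E (fst (snd r))))) leg\<rparr>"
  have src: "src (r, b) \<in> N" if "r \<in> R" for r b
    using that diag unfolding glue_diagram_def src_def by auto
  have leg: "leg (r, b) \<in> Hom E (Dom E (fst (snd r))) (D (src (r, b)))" if "r \<in> R" for r b
    using that diag unfolding glue_diagram_def src_def leg_def by (auto simp: Hom_def)
  have D: "n \<in> N \<Longrightarrow> D n \<in> Obj E" for n
    using diag unfolding glue_diagram_def by auto
  have K: "r \<in> R \<Longrightarrow> Dom E (fst (snd r)) \<in> Obj E" for r
    using leg Hom_Obj by blast
  have "category J"
    unfolding category_def J_def Hom_def using src by (auto split: sum.splits)
  moreover have "small \<kappa> (Obj J)" "small \<kappa> (Arr J)"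
    unfolding J_def using N R small_finite[of "UNIV :: bool set"]
    by (auto intro!: small_Plus small_Sigma)
  moreover have F: "is_functor J E F"
    unfolding is_functor_def
  proof (intro conjI ballI impI)
    fix x assume "x \<in> Obj J"
    then show "omap F x \<in> Obj E" "amap F (Idn J x) = Idn E (omap F x)"
      unfolding J_def F_def using D K by auto
  next
    fix x assume "x \<in> Arr J"
    then show "amap F x \<in> Hom E (omap F (Dom J x)) (omap F (Cod J x))"
      unfolding J_def F_def using leg Idn_Hom D K by auto
  next
    fix f g assume "f \<in> Arr J" "g \<in> Arr J" "Cod J f = Dom J g"
    then show "amap F (g \<odot>\<^bsub>J\<^esub> f) = amap F g \<odot>\<^bsub>E\<^esub> amap F f"
      unfolding J_def F_def
      using Cmp_Idn[OF leg] Idn_Cmp[OF leg] Idn_Cmp[OF Idn_Hom[OF D]] Idn_Cmp[OF Idn_Hom[OF K]]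
      by (auto split: sum.splits)
  qed
  ultimately obtain L c where L: "is_colimit E J F L c"
    using small_colimit_exists by blast
  have cocone_if: "is_cocone E J F M (case_sum d (\<lambda>r. d (fst r) \<odot>\<^bsub>E\<^esub> fst (snd r)))"
    if d: "glue_cocone E N D R M d" for M d
    unfolding is_cocone_def
  proof (intro conjI ballI)
    show "M \<in> Obj E" using d unfolding glue_cocone_def by blast
    have dHom: "d n \<in> Hom E (D n) M" if "n \<in> N" for n
      using d that unfolding glue_cocone_def by blast
    have deq: "d (src (r, b)) \<odot>\<^bsub>E\<^esub> leg (r, b) = d (fst r) \<odot>\<^bsub>E\<^esub> fst (snd r)" if "r \<in> R" for r b
      using d that unfolding glue_cocone_def src_def leg_def by auto
    have dr: "d (fst r) \<odot>\<^bsub>E\<^esub> fst (snd r) \<in> Hom E (Dom E (fst (snd r))) M" if "r \<in> R" for r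
      using Cmp_Hom[OF leg[OF that, of True] dHom[OF src[OF that]]]
      by (simp add: src_def leg_def)
    show "case_sum d (\<lambda>r. d (fst r) \<odot>\<^bsub>E\<^esub> fst (snd r)) x \<in> Hom E (omap F x) M"
      if "x \<in> Obj J" for x
      using that unfolding J_def F_def using dHom dr by auto
    show "case_sum d (\<lambda>r. d (fst r) \<odot>\<^bsub>E\<^esub> fst (snd r)) (Cod J u) \<odot>\<^bsub>E\<^esub> amap F u =
        case_sum d (\<lambda>r. d (fst r) \<odot>\<^bsub>E\<^esub> fst (snd r)) (Dom J u)"
      if "u \<in> Arr J" for u
      using that unfolding J_def F_def using deq Cmp_Idn[OF dHom] Cmp_Idn[OF dr] by auto
  qed
  have cL: "is_cocone E J F L c" using L unfolding is_colimit_def by blast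
  have c_leg: "c (Inl (src (r, b))) \<odot>\<^bsub>E\<^esub> leg (r, b) = c (Inr r)" if "r \<in> R" for r b
  proof -
    have "Inr (r, b) \<in> Arr J" using that by (auto simp: J_def)
    then have "c (Cod J (Inr (r, b))) \<odot>\<^bsub>E\<^esub> amap F (Inr (r, b)) = c (Dom J (Inr (r, b)))"
      using cL unfolding is_cocone_def by blast
    then show ?thesis by (simp add: J_def F_def)
  qed
  have cHom: "c (Inl n) \<in> Hom E (D n) L" if "n \<in> N" for n
  proof -
    have "Inl n \<in> Obj J" using that by (auto simp: J_def)
    then have "c (Inl n) \<in> Hom E (omap F (Inl n)) L"
      using cL unfolding is_cocone_def by blast
    then show ?thesis by (simp add: F_def)
  qed
  have "is_glue E N D R L (\<lambda>n. c (Inl n))"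
    unfolding is_glue_def
  proof (intro conjI allI impI)
    have "c (Inl n) \<odot>\<^bsub>E\<^esub> f = c (Inl n') \<odot>\<^bsub>E\<^esub> f'" if "(n, f, n', f') \<in> R" for n f n' f'
      using c_leg[OF that, of True] c_leg[OF that, of False] by (simp add: src_def leg_def)
    then show "glue_cocone E N D R L (\<lambda>n. c (Inl n))"
      using cL cHom unfolding glue_cocone_def is_cocone_def by auto
    fix M d assume d: "glue_cocone E N D R M d"
    let ?d = "case_sum d (\<lambda>r. d (fst r) \<odot>\<^bsub>E\<^esub> fst (snd r))"
    have ex: "\<exists>!h. h \<in> Hom E L M \<and> (\<forall>j\<in>Obj J. h \<odot>\<^bsub>E\<^esub> c j = ?d j)"
      using L cocone_if[OF d] unfolding is_colimit_def by blast
    have "(\<forall>j\<in>Obj J. h \<odot>\<^bsub>E\<^esub> c j = ?d j) \<longleftrightarrow> (\<forall>n\<in>N. h \<odot>\<^bsub>E\<^esub> c (Inl n) = d n)"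
      if h: "h \<in> Hom E L M" for h
    proof
      assume *: "\<forall>n\<in>N. h \<odot>\<^bsub>E\<^esub> c (Inl n) = d n"
      have "h \<odot>\<^bsub>E\<^esub> c (Inr r) = d (fst r) \<odot>\<^bsub>E\<^esub> fst (snd r)" if r: "r \<in> R" for r
        using Cmp_assoc[OF leg[OF r, of True] cHom[OF src[OF r]] h] c_leg[OF r, of True]
          * src[OF r, of True]
        by (simp add: src_def leg_def)
      then show "\<forall>j\<in>Obj J. h \<odot>\<^bsub>E\<^esub> c j = ?d j"
        using * by (auto simp: J_def)
    qed (auto simp: J_def Plus_def ball_Un)
    with ex show "\<exists>!h. h \<in> Hom E L M \<and> (\<forall>n\<in>N. h \<odot>\<^bsub>E\<^esub> c (Inl n) = d n)"
      by (metis (no_types, lifting))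
  qed
  then show ?thesis by blast
qed

lemma (in cocomplete_cat) pushout_exists:
  assumes f: "f \<in> Hom E A B" and g: "g \<in> Hom E A C"
  shows "\<exists>p q. is_pushout E f g p q"
proof -
  define D where "D = (\<lambda>b. if b then B else C)"
  let ?R = "{(True, f, False, g)}"
  have "glue_diagram E UNIV D ?R"
    using f g Hom_Obj unfolding glue_diagram_def D_def by auto
  then obtain L c where L: "is_glue E UNIV D ?R L c"
    using glue_exists small_finite by (metis finite.intros finite_code)
  have cocone: "glue_cocone E UNIV D ?R M d \<longleftrightarrow>
      d True \<in> Hom E B M \<and> d False \<in> Hom E C M \<and> d True \<odot>\<^bsub>E\<^esub> f = d False \<odot>\<^bsub>E\<^esub> g" for M d
    using Hom_Obj unfolding glue_cocone_def D_def by (auto simp: all_bool_eq)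
  have "is_pushout E f g (c True) (c False)"
    unfolding is_pushout_def
  proof (intro conjI ballI impI)
    have c: "c True \<in> Hom E B L" "c False \<in> Hom E C L" "c True \<odot>\<^bsub>E\<^esub> f = c False \<odot>\<^bsub>E\<^esub> g"
      using L cocone unfolding is_glue_def by auto
    show "f \<in> Arr E" "g \<in> Arr E" "c True \<in> Arr E" "c False \<in> Arr E" "Dom E f = Dom E g"
      "Cod E (c True) = Cod E (c False)" "Dom E (c True) = Cod E f" "Dom E (c False) = Cod E g"
      "c True \<odot>\<^bsub>E\<^esub> f = c False \<odot>\<^bsub>E\<^esub> g"
      using f g c by (auto simp: Hom_def)
    fix Z u v assume "u \<in> Hom E (Cod E f) Z" "v \<in> Hom E (Cod E g) Z" "u \<odot>\<^bsub>E\<^esub> f = v \<odot>\<^bsub>E\<^esub> g"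
    then have "glue_cocone E UNIV D ?R Z (\<lambda>b. if b then u else v)"
      unfolding cocone using f g by (auto simp: Hom_def)
    then have "\<exists>!h. h \<in> Hom E L Z \<and> (\<forall>n\<in>UNIV. h \<odot>\<^bsub>E\<^esub> c n = (if n then u else v))"
      using L unfolding is_glue_def by blast
    then show "\<exists>!h. h \<in> Hom E (Cod E (c True)) Z \<and> h \<odot>\<^bsub>E\<^esub> c True = u \<and> h \<odot>\<^bsub>E\<^esub> c False = v"
      using Hom_Cod[OF c(1)] by (simp add: all_bool_eq)
  qed
  then show ?thesis by blast
qed

section \<open>Small objects\<close>

lemma poset_cat_simps:
  "Obj (poset_cat P r) = P" "Arr (poset_cat P r) = r" "Dom (poset_cat P r) = fst"
  "Cod (poset_cat P r) = snd" "Idn (poset_cat P r) i = (i, i)"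
  "v \<odot>\<^bsub>poset_cat P r\<^esub> u = (fst u, snd v)"
  by (simp_all add: poset_cat_def)

lemma poset_functor_amap:
  assumes "is_functor (poset_cat P r) E D"
  shows "(i, j) \<in> r \<Longrightarrow> amap D (i, j) \<in> Hom E (omap D i) (omap D j)"
    and "i \<in> P \<Longrightarrow> amap D (i, i) = Idn E (omap D i)"
    and "(i, j) \<in> r \<Longrightarrow> (j, k) \<in> r \<Longrightarrow> amap D (j, k) \<odot>\<^bsub>E\<^esub> amap D (i, j) = amap D (i, k)"
  using assms unfolding is_functor_def poset_cat_simps by fastforce+

lemma poset_cocone:
  assumes "is_cocone E (poset_cat P r) D L c"
  shows "i \<in> P \<Longrightarrow> c i \<in> Hom E (omap D i) L"
    and "(i, j) \<in> r \<Longrightarrow> c j \<odot>\<^bsub>E\<^esub> amap D (i, j) = c i"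
  using assms unfolding is_cocone_def poset_cat_simps by fastforce+

text \<open>
  Preservation of a colimit by \<open>hom(K, -)\<close> is a universal property with respect to small sets of
  labels. The next two lemmas recover from it the concrete description of maps into a directed
  colimit. Two labels suffice for both.
\<close>

locale compact_in_directed_colimit = universe \<kappa> + cat E
  for \<kappa> :: "'u rel" and E :: "('o, 'm) cat" +
  fixes P :: "'p set" and r :: "'p rel" and D L c K
  assumes po: "partial_order_on P r"
    and directed: "\<And>i j. i \<in> P \<Longrightarrow> j \<in> P \<Longrightarrow> \<exists>k\<in>P. (i, k) \<in> r \<and> (j, k) \<in> r"
    and D: "is_functor (poset_cat P r) E D"
    and cocone: "is_cocone E (poset_cat P r) D L c"
    and K: "hom_preserves_colimit \<kappa> E K (poset_cat P r) D L c"
begin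

lemma r_in: "(i, j) \<in> r \<Longrightarrow> i \<in> P \<and> j \<in> P"
  and r_refl: "i \<in> P \<Longrightarrow> (i, i) \<in> r"
  and r_trans: "(i, j) \<in> r \<Longrightarrow> (j, k) \<in> r \<Longrightarrow> (i, k) \<in> r"
  using po unfolding partial_order_on_def preorder_on_def refl_on_def by (auto dest: transD)

lemma distinct_labels:
  obtains a b :: 'u where "a \<noteq> b" "small \<kappa> {a, b}"
proof -
  obtain e :: "bool \<Rightarrow> 'u" where "inj_on e UNIV"
    using small_embeds[OF small_finite[of "UNIV :: bool set"]] by auto
  then have "e True \<noteq> e False" by (simp add: inj_eq)
  then show ?thesis by (rule that) (simp add: small_finite)
qed

text \<open>
  Label by \<open>a\<close> the arrows \<open>K \<rightarrow> L\<close> that factor through a stage, and the others by \<open>b\<close>. This labelling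
  restricts to the constant one on every stage, so by uniqueness it is constant.
\<close>

lemma arrow_to_colimit_factors:
  assumes f: "f \<in> Hom E K L"
  shows "\<exists>j\<in>P. \<exists>f'\<in>Hom E K (omap D j). c j \<odot>\<^bsub>E\<^esub> f' = f"
proof -
  obtain a b :: 'u where ab: "a \<noteq> b" "small \<kappa> {a, b}"
    by (rule distinct_labels)
  let ?im = "\<lambda>x. \<exists>j\<in>P. \<exists>f'\<in>Hom E K (omap D j). c j \<odot>\<^bsub>E\<^esub> f' = x"
  have ex: "\<exists>!w. w \<in> Hom E K L \<rightarrow>\<^sub>E {a, b} \<and>
      (\<forall>j\<in>P. \<forall>f\<in>Hom E K (omap D j). w (c j \<odot>\<^bsub>E\<^esub> f) = a)" (is "\<exists>!w. ?Q w")
    using K[unfolded hom_preserves_colimit_def poset_cat_simps, rule_format, of "{a, b}" "\<lambda>_ _. a"]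
      ab by auto
  have unique: "w = w'" if "?Q w" "?Q w'" for w w'
    using the1_equality[OF ex, of w] the1_equality[OF ex, of w'] that by argo
  have "?Q (\<lambda>x\<in>Hom E K L. a)"
    using Cmp_Hom poset_cocone(1)[OF cocone] by auto
  moreover have "?Q (\<lambda>x\<in>Hom E K L. if ?im x then a else b)"
    using Cmp_Hom poset_cocone(1)[OF cocone] by auto
  ultimately have "(\<lambda>x\<in>Hom E K L. a) = (\<lambda>x\<in>Hom E K L. if ?im x then a else b)"
    by (rule unique)
  then have "(\<lambda>x\<in>Hom E K L. a) f = (\<lambda>x\<in>Hom E K L. if ?im x then a else b) f"
    by (rule arg_cong)
  then show ?thesis
    using ab f by (simp split: if_splits)
qed

text \<open>
  Label by \<open>a\<close> those arrows into a stage that eventually become equal to \<open>f\<close>, and the others by \<open>b\<close>.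
  This labelling is compatible with the transition maps, so it depends only on the composite to
  the colimit. The arrow \<open>f\<close> carries the label \<open>a\<close>, hence so does \<open>f'\<close>.
\<close>

lemma arrows_equal_at_later_stage:
  assumes j: "j \<in> P" and f: "f \<in> Hom E K (omap D j)" and f': "f' \<in> Hom E K (omap D j)"
    and eq: "c j \<odot>\<^bsub>E\<^esub> f = c j \<odot>\<^bsub>E\<^esub> f'"
  shows "\<exists>l. (j, l) \<in> r \<and> amap D (j, l) \<odot>\<^bsub>E\<^esub> f = amap D (j, l) \<odot>\<^bsub>E\<^esub> f'"
proof -
  obtain a b :: 'u where ab: "a \<noteq> b" "small \<kappa> {a, b}"
    by (rule distinct_labels)
  define Q where "Q k g \<longleftrightarrow>
    (\<exists>l. (j, l) \<in> r \<and> (k, l) \<in> r \<and> amap D (k, l) \<odot>\<^bsub>E\<^esub> g = amap D (j, l) \<odot>\<^bsub>E\<^esub> f)" for k g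
  have Q: "Q k' (amap D (k, k') \<odot>\<^bsub>E\<^esub> g) \<longleftrightarrow> Q k g"
    if k: "(k, k') \<in> r" and g: "g \<in> Hom E K (omap D k)" for k k' g
  proof
    assume "Q k g"
    then obtain l where l: "(j, l) \<in> r" "(k, l) \<in> r"
        "amap D (k, l) \<odot>\<^bsub>E\<^esub> g = amap D (j, l) \<odot>\<^bsub>E\<^esub> f"
      unfolding Q_def by blast
    obtain l' where l': "(l, l') \<in> r" "(k', l') \<in> r"
      using directed r_in k l by metis
    have "amap D (k', l') \<odot>\<^bsub>E\<^esub> (amap D (k, k') \<odot>\<^bsub>E\<^esub> g) = amap D (k, l') \<odot>\<^bsub>E\<^esub> g"
      using Cmp_assoc[OF g poset_functor_amap(1)[OF D k] poset_functor_amap(1)[OF D l'(2)]]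
        poset_functor_amap(3)[OF D k l'(2)] by simp
    also have "\<dots> = amap D (l, l') \<odot>\<^bsub>E\<^esub> (amap D (k, l) \<odot>\<^bsub>E\<^esub> g)"
      using Cmp_assoc[OF g poset_functor_amap(1)[OF D l(2)] poset_functor_amap(1)[OF D l'(1)]]
        poset_functor_amap(3)[OF D l(2) l'(1)] by simp
    also have "\<dots> = amap D (j, l') \<odot>\<^bsub>E\<^esub> f"
      using Cmp_assoc[OF f poset_functor_amap(1)[OF D l(1)] poset_functor_amap(1)[OF D l'(1)]]
        poset_functor_amap(3)[OF D l(1) l'(1)] l(3) by simp
    finally show "Q k' (amap D (k, k') \<odot>\<^bsub>E\<^esub> g)"
      unfolding Q_def using l l' r_trans by blast
  next
    assume "Q k' (amap D (k, k') \<odot>\<^bsub>E\<^esub> g)"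
    then obtain l where l: "(j, l) \<in> r" "(k', l) \<in> r"
        "amap D (k', l) \<odot>\<^bsub>E\<^esub> (amap D (k, k') \<odot>\<^bsub>E\<^esub> g) = amap D (j, l) \<odot>\<^bsub>E\<^esub> f"
      unfolding Q_def by blast
    have "amap D (k, l) \<odot>\<^bsub>E\<^esub> g = amap D (j, l) \<odot>\<^bsub>E\<^esub> f"
      using Cmp_assoc[OF g poset_functor_amap(1)[OF D k] poset_functor_amap(1)[OF D l(2)]]
        poset_functor_amap(3)[OF D k l(2)] l(3) by simp
    then show "Q k g"
      unfolding Q_def using l k r_trans by blast
  qed
  have Q': "Q (snd e) (amap D e \<odot>\<^bsub>E\<^esub> g) \<longleftrightarrow> Q (fst e) g"
    if "e \<in> r" "g \<in> Hom E K (omap D (fst e))" for e g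
    using Q[of "fst e" "snd e"] that by simp
  have "\<exists>!w. w \<in> Hom E K L \<rightarrow>\<^sub>E {a, b} \<and>
      (\<forall>k\<in>P. \<forall>g\<in>Hom E K (omap D k). w (c k \<odot>\<^bsub>E\<^esub> g) = (if Q k g then a else b))"
    by (rule K[unfolded hom_preserves_colimit_def poset_cat_simps, rule_format,
        of "{a, b}" "\<lambda>k g. if Q k g then a else b"]) (use ab in \<open>auto simp: Q'\<close>)
  then obtain w where w: "\<And>k g. k \<in> P \<Longrightarrow> g \<in> Hom E K (omap D k) \<Longrightarrow>
      w (c k \<odot>\<^bsub>E\<^esub> g) = (if Q k g then a else b)"
    by blast
  have "Q j f"
    unfolding Q_def using r_refl[OF j] by blast
  then have "Q j f'"
    using w[OF j f] w[OF j f'] eq ab by (simp split: if_splits)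
  then show ?thesis
    unfolding Q_def by force
qed

end

text \<open>
  This is smallness as the small object argument uses it: the factorization through a stage need not
  be unique in any sense.
\<close>

definition small_for_chains :: "('o, 'm) cat \<Rightarrow> 'l rel \<Rightarrow> 'o \<Rightarrow> bool" where
  "small_for_chains E \<theta> A \<longleftrightarrow>
     (\<forall>D L c. is_functor (poset_cat (Field \<theta>) \<theta>) E D \<and>
        is_colimit E (poset_cat (Field \<theta>) \<theta>) D L c \<longrightarrow>
        (\<forall>u\<in>Hom E A L. \<exists>a\<in>Field \<theta>. \<exists>u'\<in>Hom E A (omap D a). c a \<odot>\<^bsub>E\<^esub> u' = u))"

lemma regular_cardinal_well_order:
  "regular_cardinal \<theta> \<Longrightarrow> Well_order \<theta>"
  unfolding regular_cardinal_def card_order_on_def by blast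

lemma regular_cardinal_directed:
  assumes \<theta>: "regular_cardinal \<theta>" and \<mu>: "\<mu> \<le>o \<theta>"
  shows "directed_poset \<mu> (Field \<theta>) \<theta>"
  unfolding directed_poset_def
proof (intro conjI allI impI)
  show "partial_order_on (Field \<theta>) \<theta>"
    using regular_cardinal_well_order[OF \<theta>]
    unfolding well_order_on_def linear_order_on_def by blast
  fix S assume "S \<subseteq> Field \<theta>" "|S| <o \<mu>"
  then show "\<exists>b\<in>Field \<theta>. \<forall>a\<in>S. (a, b) \<in> \<theta>"
    using regular_cardinal_bounded[OF \<theta>] ordLess_ordLeq_trans[OF _ \<mu>] by blast
qed

lemma (in cat) is_colimit_unique:
  assumes L: "is_colimit E J D L c" and h: "h \<in> Hom E L M" "h' \<in> Hom E L M"
    and eq: "\<And>j. j \<in> Obj J \<Longrightarrow> h \<odot>\<^bsub>E\<^esub> c j = h' \<odot>\<^bsub>E\<^esub> c j"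
    and J: "category J" and D: "is_functor J E D"
  shows "h = h'"
proof -
  interpret J: cat J by unfold_locales (rule J)
  have c: "\<And>j. j \<in> Obj J \<Longrightarrow> c j \<in> Hom E (omap D j) L"
    and rel: "\<And>u. u \<in> Arr J \<Longrightarrow> c (Cod J u) \<odot>\<^bsub>E\<^esub> amap D u = c (Dom J u)"
    and DA: "\<And>u. u \<in> Arr J \<Longrightarrow> amap D u \<in> Hom E (omap D (Dom J u)) (omap D (Cod J u))"
    using L D unfolding is_colimit_def is_cocone_def is_functor_def by blast+
  have "(h \<odot>\<^bsub>E\<^esub> c (Cod J u)) \<odot>\<^bsub>E\<^esub> amap D u = h \<odot>\<^bsub>E\<^esub> c (Dom J u)" if u: "u \<in> Arr J" for u
    using Cmp_assoc[OF DA[OF u] c[OF J.Cod_Obj[OF u]] h(1)] rel[OF u] by simp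
  then have "is_cocone E J D M (\<lambda>j. h \<odot>\<^bsub>E\<^esub> c j)"
    unfolding is_cocone_def using Hom_Obj[OF h(1)] Cmp_Hom[OF c h(1)] by blast
  then have "\<exists>!k. k \<in> Hom E L M \<and> (\<forall>j\<in>Obj J. k \<odot>\<^bsub>E\<^esub> c j = h \<odot>\<^bsub>E\<^esub> c j)"
    using L unfolding is_colimit_def by blast
  then show ?thesis using h eq by metis
qed

locale presentable_cat = universe \<kappa> + cat E
  for \<kappa> :: "'u rel" and E :: "('o, 'm) cat" +
  assumes presentable: "locally_presentable \<kappa> E"

sublocale presentable_cat \<subseteq> cocomplete_cat
  by unfold_locales (use presentable locally_presentable_def in blast)

context presentable_cat
begin

text \<open>
  The arrow \<open>u : A \<rightarrow> L\<close> is tested on the presentable objects \<open>B i\<close> of which \<open>A\<close> is the colimit.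
  Each restriction \<open>u k\<^sub>i\<close> factors through a stage \<open>a i\<close>, by an arrow \<open>v i\<close>, and for each \<open>(i, j) \<in> r\<close>
  the arrows \<open>v i\<close> and \<open>v j\<close> become compatible at a stage \<open>b (i, j)\<close>. There are fewer than \<open>\<theta>\<close> such
  pairs, so all these stages lie below one stage \<open>z\<close>, where the \<open>v i\<close> form a cocone.
\<close>

lemma small_for_long_chains:
  fixes \<theta> \<mu> :: "'u rel" and P :: "'p set"
  assumes \<theta>: "regular_cardinal \<theta>" "\<theta> <o \<kappa>" "\<mu> \<le>o \<theta>" "|r| <o \<theta>"
    and po: "partial_order_on P r"
    and B: "is_functor (poset_cat P r) E B" "\<And>i. i \<in> P \<Longrightarrow> presentable \<kappa> \<mu> E (omap B i)"
    and A: "is_colimit E (poset_cat P r) B A k"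
  shows "small_for_chains E \<theta> A"
  unfolding small_for_chains_def
proof (intro allI impI ballI; elim conjE)
  fix D L c u
  assume D: "is_functor (poset_cat (Field \<theta>) \<theta>) E D"
    and L: "is_colimit E (poset_cat (Field \<theta>) \<theta>) D L c" and u: "u \<in> Hom E A L"
  have r_in: "(i, j) \<in> r \<Longrightarrow> i \<in> P \<and> j \<in> P" and r_refl: "i \<in> P \<Longrightarrow> (i, i) \<in> r" for i j
    using po unfolding partial_order_on_def preorder_on_def refl_on_def by auto
  have dir: "directed_poset \<mu> (Field \<theta>) \<theta>"
    by (rule regular_cardinal_directed[OF \<theta>(1,3)])
  have po\<theta>: "partial_order_on (Field \<theta>) \<theta>"
    using dir unfolding directed_poset_def by blast
  have \<theta>_trans: "(x, y) \<in> \<theta> \<Longrightarrow> (y, z) \<in> \<theta> \<Longrightarrow> (x, z) \<in> \<theta>" for x y z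
    using po\<theta> unfolding partial_order_on_def preorder_on_def by (auto dest: transD)
  have \<theta>_in: "(x, y) \<in> \<theta> \<Longrightarrow> x \<in> Field \<theta> \<and> y \<in> Field \<theta>" for x y
    by (auto simp: Field_def)
  have upper: "\<exists>z\<in>Field \<theta>. (x, z) \<in> \<theta> \<and> (y, z) \<in> \<theta>"
    if "x \<in> Field \<theta>" "y \<in> Field \<theta>" for x y
    using regular_cardinal_well_order[OF \<theta>(1)] that
    unfolding well_order_on_def linear_order_on_def partial_order_on_def preorder_on_def
      refl_on_def total_on_def by metis
  have small: "small \<kappa> (Field \<theta>)"
    using \<theta> unfolding small_def regular_cardinal_def
    by (simp add: ordIso_ordLess_trans[OF card_of_Field_ordIso])
  have cocone: "is_cocone E (poset_cat (Field \<theta>) \<theta>) D L c"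
    using L unfolding is_colimit_def by blast
  have k_cocone: "is_cocone E (poset_cat P r) B A k"
    using A unfolding is_colimit_def by blast
  have compact: "compact_in_directed_colimit \<kappa> E (Field \<theta>) \<theta> D L c (omap B i)" if "i \<in> P" for i
  proof unfold_locales
    show "hom_preserves_colimit \<kappa> E (omap B i) (poset_cat (Field \<theta>) \<theta>) D L c"
      using B(2)[OF that] dir small D L unfolding presentable_def by blast
  qed (use po\<theta> upper D cocone in auto)
  have "\<exists>a v. a \<in> Field \<theta> \<and> v \<in> Hom E (omap B i) (omap D a) \<and> c a \<odot>\<^bsub>E\<^esub> v = u \<odot>\<^bsub>E\<^esub> k i"
    if i: "i \<in> P" for i
    using compact_in_directed_colimit.arrow_to_colimit_factors[OF compact[OF i]
        Cmp_Hom[OF poset_cocone(1)[OF k_cocone i] u]] by blast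
  then obtain a v where a: "\<And>i. i \<in> P \<Longrightarrow> a i \<in> Field \<theta>"
    and v: "\<And>i. i \<in> P \<Longrightarrow> v i \<in> Hom E (omap B i) (omap D (a i))"
    and cv: "\<And>i. i \<in> P \<Longrightarrow> c (a i) \<odot>\<^bsub>E\<^esub> v i = u \<odot>\<^bsub>E\<^esub> k i"
    by metis
  have "\<exists>b. (a i, b) \<in> \<theta> \<and> (a j, b) \<in> \<theta> \<and>
      amap D (a j, b) \<odot>\<^bsub>E\<^esub> (v j \<odot>\<^bsub>E\<^esub> amap B (i, j)) = amap D (a i, b) \<odot>\<^bsub>E\<^esub> v i"
    if ij: "(i, j) \<in> r" for i j
  proof -
    have i: "i \<in> P" and j: "j \<in> P" using r_in ij by auto
    obtain z where z: "(a i, z) \<in> \<theta>" "(a j, z) \<in> \<theta>"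
      using upper a i j by blast
    note Dz = poset_functor_amap(1)[OF D z(1)] poset_functor_amap(1)[OF D z(2)]
    note Bij = poset_functor_amap(1)[OF B(1) ij]
    note vB = Cmp_Hom[OF Bij v[OF j]]
    have zF: "z \<in> Field \<theta>" using z by (auto simp: Field_def)
    note cz = poset_cocone(1)[OF cocone zF]
    have "c z \<odot>\<^bsub>E\<^esub> (amap D (a j, z) \<odot>\<^bsub>E\<^esub> (v j \<odot>\<^bsub>E\<^esub> amap B (i, j)))
        = c (a j) \<odot>\<^bsub>E\<^esub> (v j \<odot>\<^bsub>E\<^esub> amap B (i, j))"
      using Cmp_assoc[OF vB Dz(2) cz] poset_cocone(2)[OF cocone z(2)] by simp
    also have "\<dots> = (u \<odot>\<^bsub>E\<^esub> k j) \<odot>\<^bsub>E\<^esub> amap B (i, j)"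
      using Cmp_assoc[OF Bij v[OF j] poset_cocone(1)[OF cocone a[OF j]]] cv[OF j] by simp
    also have "\<dots> = u \<odot>\<^bsub>E\<^esub> k i"
      using Cmp_assoc[OF Bij poset_cocone(1)[OF k_cocone j] u] poset_cocone(2)[OF k_cocone ij]
      by simp
    also have "\<dots> = c (a i) \<odot>\<^bsub>E\<^esub> v i"
      using cv[OF i] by simp
    also have "\<dots> = c z \<odot>\<^bsub>E\<^esub> (amap D (a i, z) \<odot>\<^bsub>E\<^esub> v i)"
      using Cmp_assoc[OF v[OF i] Dz(1) cz] poset_cocone(2)[OF cocone z(1)] by simp
    finally obtain b where b: "(z, b) \<in> \<theta>"
        "amap D (z, b) \<odot>\<^bsub>E\<^esub> (amap D (a j, z) \<odot>\<^bsub>E\<^esub> (v j \<odot>\<^bsub>E\<^esub> amap B (i, j)))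
          = amap D (z, b) \<odot>\<^bsub>E\<^esub> (amap D (a i, z) \<odot>\<^bsub>E\<^esub> v i)"
      using compact_in_directed_colimit.arrows_equal_at_later_stage[OF compact[OF i] zF
          Cmp_Hom[OF vB Dz(2)] Cmp_Hom[OF v[OF i] Dz(1)]] by blast
    note Db = poset_functor_amap(1)[OF D b(1)]
    show ?thesis
      using b Cmp_assoc[OF vB Dz(2) Db] Cmp_assoc[OF v[OF i] Dz(1) Db]
        poset_functor_amap(3)[OF D z(2) b(1)] poset_functor_amap(3)[OF D z(1) b(1)]
        \<theta>_trans[OF z(1) b(1)] \<theta>_trans[OF z(2) b(1)] by auto
  qed
  then have "\<forall>ij\<in>r. \<exists>b. (a (fst ij), b) \<in> \<theta> \<and> (a (snd ij), b) \<in> \<theta> \<and>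
      amap D (a (snd ij), b) \<odot>\<^bsub>E\<^esub> (v (snd ij) \<odot>\<^bsub>E\<^esub> amap B ij) = amap D (a (fst ij), b) \<odot>\<^bsub>E\<^esub> v (fst ij)"
    by auto
  then obtain b where "\<forall>ij\<in>r. (a (fst ij), b ij) \<in> \<theta> \<and> (a (snd ij), b ij) \<in> \<theta> \<and>
      amap D (a (snd ij), b ij) \<odot>\<^bsub>E\<^esub> (v (snd ij) \<odot>\<^bsub>E\<^esub> amap B ij)
        = amap D (a (fst ij), b ij) \<odot>\<^bsub>E\<^esub> v (fst ij)"
    using bchoice by meson
  then have b: "(a i, b (i, j)) \<in> \<theta>" "(a j, b (i, j)) \<in> \<theta>"
      "amap D (a j, b (i, j)) \<odot>\<^bsub>E\<^esub> (v j \<odot>\<^bsub>E\<^esub> amap B (i, j)) = amap D (a i, b (i, j)) \<odot>\<^bsub>E\<^esub> v i"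
    if "(i, j) \<in> r" for i j
    using that by fastforce+
  have "b ` r \<subseteq> Field \<theta>" using \<theta>_in[OF b(1)] by auto
  moreover have "|b ` r| <o \<theta>"
    using card_of_image \<theta>(4) by (rule ordLeq_ordLess_trans)
  \<comment> \<open>The bound \<open>z\<close> is also above every \<open>a i\<close>, because \<open>r\<close> contains the pair \<open>(i, i)\<close>.\<close>
  ultimately obtain z where zF: "z \<in> Field \<theta>" and z: "\<And>i j. (i, j) \<in> r \<Longrightarrow> (b (i, j), z) \<in> \<theta>"
    using regular_cardinal_bounded[OF \<theta>(1)] by (metis imageI)
  have az: "(a i, z) \<in> \<theta>" if "i \<in> P" for i
    using b(1) z \<theta>_trans r_refl[OF that] by blast
  define w where "w i = amap D (a i, z) \<odot>\<^bsub>E\<^esub> v i" for i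
  have w: "w i \<in> Hom E (omap B i) (omap D z)" if "i \<in> P" for i
    unfolding w_def using Cmp_Hom[OF v[OF that] poset_functor_amap(1)[OF D az[OF that]]] .
  have w_rel: "w j \<odot>\<^bsub>E\<^esub> amap B (i, j) = w i" if ij: "(i, j) \<in> r" for i j
  proof -
    have i: "i \<in> P" and j: "j \<in> P" using r_in ij by auto
    note Bij = poset_functor_amap(1)[OF B(1) ij]
    note vB = Cmp_Hom[OF Bij v[OF j]]
    note Db = poset_functor_amap(1)[OF D b(1)[OF ij]] poset_functor_amap(1)[OF D b(2)[OF ij]]
    note Dz = poset_functor_amap(1)[OF D z[OF ij]]
    have "w j \<odot>\<^bsub>E\<^esub> amap B (i, j) = amap D (a j, z) \<odot>\<^bsub>E\<^esub> (v j \<odot>\<^bsub>E\<^esub> amap B (i, j))"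
      unfolding w_def using Cmp_assoc[OF Bij v[OF j] poset_functor_amap(1)[OF D az[OF j]]] .
    also have "\<dots> = amap D (b (i, j), z) \<odot>\<^bsub>E\<^esub> (amap D (a j, b (i, j)) \<odot>\<^bsub>E\<^esub> (v j \<odot>\<^bsub>E\<^esub> amap B (i, j)))"
      using Cmp_assoc[OF vB Db(2) Dz] poset_functor_amap(3)[OF D b(2)[OF ij] z[OF ij]] by simp
    also have "\<dots> = amap D (b (i, j), z) \<odot>\<^bsub>E\<^esub> (amap D (a i, b (i, j)) \<odot>\<^bsub>E\<^esub> v i)"
      using b(3)[OF ij] by simp
    also have "\<dots> = w i"
      unfolding w_def
      using Cmp_assoc[OF v[OF i] Db(1) Dz] poset_functor_amap(3)[OF D b(1)[OF ij] z[OF ij]] by simp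
    finally show ?thesis .
  qed
  have "is_cocone E (poset_cat P r) B (omap D z) w"
    unfolding is_cocone_def poset_cat_simps
    using w w_rel Hom_Obj[OF poset_cocone(1)[OF cocone zF]] by auto
  then obtain u' where u': "u' \<in> Hom E A (omap D z)" and u'k: "\<And>i. i \<in> P \<Longrightarrow> u' \<odot>\<^bsub>E\<^esub> k i = w i"
    using A unfolding is_colimit_def poset_cat_simps by blast
  have "c z \<odot>\<^bsub>E\<^esub> u' = u"
  proof (rule is_colimit_unique[OF A _ u])
    show "c z \<odot>\<^bsub>E\<^esub> u' \<in> Hom E A L"
      using Cmp_Hom[OF u' poset_cocone(1)[OF cocone zF]] .
    fix i assume "i \<in> Obj (poset_cat P r)"
    then have i: "i \<in> P" by (simp add: poset_cat_simps)
    note cz = poset_cocone(1)[OF cocone zF]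
    have "(c z \<odot>\<^bsub>E\<^esub> u') \<odot>\<^bsub>E\<^esub> k i = c z \<odot>\<^bsub>E\<^esub> w i"
      using Cmp_assoc[OF poset_cocone(1)[OF k_cocone i] u' cz] u'k[OF i] by simp
    also have "\<dots> = u \<odot>\<^bsub>E\<^esub> k i"
      unfolding w_def using Cmp_assoc[OF v[OF i] poset_functor_amap(1)[OF D az[OF i]] cz]
        poset_cocone(2)[OF cocone az[OF i]] cv[OF i] by simp
    finally show "(c z \<odot>\<^bsub>E\<^esub> u') \<odot>\<^bsub>E\<^esub> k i = u \<odot>\<^bsub>E\<^esub> k i" .
  qed (use category_poset_cat[OF po] B(1) in auto)
  then show "\<exists>a\<in>Field \<theta>. \<exists>u'\<in>Hom E A (omap D a). c a \<odot>\<^bsub>E\<^esub> u' = u"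
    using zF u' by blast
qed

text \<open>
  Every object in \<open>\<A>\<close> is the colimit of a small diagram of \<open>\<mu>\<close>-presentable objects. As \<open>\<kappa>\<close> is regular,
  the orders of these diagrams have a small union, and any regular \<open>\<theta>\<close> above both \<open>\<mu>\<close> and this
  union is long enough for all of them.
\<close>

lemma common_chain_length:
  assumes \<A>: "small \<kappa> \<A>" "\<A> \<subseteq> Obj E"
  shows "\<exists>\<theta> :: 'u rel. regular_cardinal \<theta> \<and> \<theta> <o \<kappa> \<and> (\<forall>A\<in>\<A>. small_for_chains E \<theta> A)"
proof -
  obtain \<mu> :: "'u rel" and G where \<mu>: "regular_cardinal \<mu>" "\<mu> <o \<kappa>"
    and G: "\<forall>K\<in>G. presentable \<kappa> \<mu> E K"
    and pres: "\<forall>X\<in>Obj E. \<exists>(P :: 'u set) r D c.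
              directed_poset \<mu> P r \<and> small \<kappa> P \<and> is_functor (poset_cat P r) E D \<and>
              (\<forall>i\<in>P. omap D i \<in> G) \<and> is_colimit E (poset_cat P r) D X c"
    using presentable unfolding locally_presentable_def by blast
  define pr where "pr X P r D c \<longleftrightarrow> directed_poset \<mu> P r \<and> small \<kappa> P \<and>
    is_functor (poset_cat P r) E D \<and> (\<forall>i\<in>P. omap D i \<in> G) \<and> is_colimit E (poset_cat P r) D X c"
    for X and P :: "'u set" and r D c
  have "\<forall>A\<in>\<A>. \<exists>r. \<exists>P D c. pr A P r D c"
    using \<A> pres unfolding pr_def by blast
  then obtain r where r: "\<forall>A\<in>\<A>. \<exists>P D c. pr A P (r A) D c"
    by (meson bchoice)
  have "small \<kappa> (r A)" if "A \<in> \<A>" for A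
  proof -
    obtain P D c where *: "pr A P (r A) D c" using r \<open>A \<in> \<A>\<close> by blast
    then have "r A \<subseteq> P \<times> P"
      unfolding pr_def directed_poset_def partial_order_on_def preorder_on_def by blast
    moreover have "small \<kappa> (P \<times> P)"
      using * by (auto simp: pr_def intro!: small_Sigma)
    ultimately show ?thesis by (rule small_subset)
  qed
  then have R: "small \<kappa> (\<Union>A\<in>\<A>. r A)"
    using \<A> by (intro small_UN) auto
  have \<mu>_iso: "|Field \<mu>| =o \<mu>"
    using \<mu> by (simp add: card_of_Field_ordIso regular_cardinal_def)
  then have "small \<kappa> (Field \<mu>)"
    unfolding small_def using \<mu>(2) by (rule ordIso_ordLess_trans)
  then obtain \<theta> :: "'u rel" where \<theta>: "regular_cardinal \<theta>" "\<theta> <o \<kappa>"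
      "|Field \<mu> <+> (\<Union>A\<in>\<A>. r A)| <o \<theta>"
    using ex_regular_cardinal_above[OF small_Plus[OF _ R]] by blast
  have "|Field \<mu>| <o \<theta>"
    using card_of_Plus1 \<theta>(3) by (rule ordLeq_ordLess_trans)
  then have \<mu>\<theta>: "\<mu> \<le>o \<theta>"
    by (rule ordLess_imp_ordLeq[OF ordIso_ordLess_trans[OF ordIso_symmetric[OF \<mu>_iso]]])
  have R\<theta>: "|\<Union>A\<in>\<A>. r A| <o \<theta>"
    using card_of_Plus2 \<theta>(3) by (rule ordLeq_ordLess_trans)
  have r\<theta>: "|r A| <o \<theta>" if "A \<in> \<A>" for A
  proof -
    have "r A \<subseteq> (\<Union>A\<in>\<A>. r A)" using that by blast
    then show ?thesis by (rule ordLeq_ordLess_trans[OF card_of_mono1 R\<theta>])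
  qed
  have "small_for_chains E \<theta> A" if A: "A \<in> \<A>" for A
  proof -
    obtain P D c where *: "pr A P (r A) D c" using r \<open>A \<in> \<A>\<close> by blast
    show ?thesis
      using small_for_long_chains[where P = P and B = D and k = c, OF \<theta>(1,2) \<mu>\<theta> r\<theta>[OF A]] * G
      unfolding pr_def directed_poset_def by blast
  qed
  then show ?thesis using \<theta> by blast
qed

end

section \<open>Towers of cell attachments\<close>

text \<open>
  The pieces from which a stage is glued: the object \<open>X\<close>, an earlier stage \<open>b\<close>, and the cell that
  solves the lifting problem \<open>(u, v)\<close> of the arrow \<open>i\<close> against the projection of stage \<open>b\<close> to \<open>Y\<close>.
\<close>

datatype ('i, 'm) node = Base | Stage 'i | Cell 'i 'm 'm 'm

text \<open>
  The value of a tower at \<open>a\<close> consists of the object at stage \<open>a\<close>, the coprojections of its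
  nodes, and its projection to \<open>Y\<close>. The transition maps of the tower are the coprojections
  of the nodes \<open>Stage b\<close>.
\<close>

type_synonym ('u, 'o, 'm) tower = "'u \<Rightarrow> 'o \<times> (('u, 'm) node \<Rightarrow> 'm) \<times> 'm"

locale small_object_argument = presentable_cat \<kappa> E
  for \<kappa> :: "'u rel" and E :: "('o, 'm) cat" +
  fixes \<theta> :: "'u rel" and S :: "'m set" and f :: 'm
  assumes \<theta>: "regular_cardinal \<theta>" "\<theta> <o \<kappa>"
    and S: "S \<subseteq> Arr E" "small \<kappa> S"
    and small_dom: "\<And>i. i \<in> S \<Longrightarrow> small_for_chains E \<theta> (Dom E i)"
    and f: "f \<in> Arr E"
begin

abbreviation "X \<equiv> Dom E f"
abbreviation "Y \<equiv> Cod E f"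

abbreviation carrier :: "('u, 'o, 'm) tower \<Rightarrow> 'u \<Rightarrow> 'o" where
  "carrier F a \<equiv> fst (F a)"
abbreviation incl :: "('u, 'o, 'm) tower \<Rightarrow> 'u \<Rightarrow> ('u, 'm) node \<Rightarrow> 'm" where
  "incl F a \<equiv> fst (snd (F a))"
abbreviation proj :: "('u, 'o, 'm) tower \<Rightarrow> 'u \<Rightarrow> 'm" where
  "proj F a \<equiv> snd (snd (F a))"

definition nodes :: "('u, 'o, 'm) tower \<Rightarrow> 'u \<Rightarrow> ('u, 'm) node set" where
  "nodes F a = {Base} \<union> Stage ` underS \<theta> a \<union>
     {Cell b i u v | b i u v. b \<in> underS \<theta> a \<and> i \<in> S \<and> u \<in> Hom E (Dom E i) (carrier F b) \<and>
        v \<in> Hom E (Cod E i) Y \<and> proj F b \<odot>\<^bsub>E\<^esub> u = v \<odot>\<^bsub>E\<^esub> i}"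

fun node_obj :: "('u, 'o, 'm) tower \<Rightarrow> ('u, 'm) node \<Rightarrow> 'o" where
  "node_obj F Base = X"
| "node_obj F (Stage b) = carrier F b"
| "node_obj F (Cell b i u v) = Cod E i"

fun node_proj :: "('u, 'o, 'm) tower \<Rightarrow> ('u, 'm) node \<Rightarrow> 'm" where
  "node_proj F Base = f"
| "node_proj F (Stage b) = proj F b"
| "node_proj F (Cell b i u v) = v"

text \<open>
  The first two kinds of relations make the coprojections a cocone on the chain that consists of \<open>X\<close>
  and the earlier stages; identities fill the side on which there is nothing to compose with. The
  third kind attaches a cell along its boundary.
\<close>

definition node_rels :: "('u, 'o, 'm) tower \<Rightarrow> 'u
    \<Rightarrow> (('u, 'm) node \<times> 'm \<times> ('u, 'm) node \<times> 'm) set" where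
  "node_rels F a =
     {(Base, Idn E X, Stage b, incl F b Base) | b. b \<in> underS \<theta> a} \<union>
     {(Stage b', Idn E (carrier F b'), Stage b, incl F b (Stage b')) | b b'.
        b \<in> underS \<theta> a \<and> b' \<in> underS \<theta> b} \<union>
     {(Stage b, u, Cell b i u v, i) | b i u v. Cell b i u v \<in> nodes F a}"

text \<open>
  The same condition serves zero, successor and limit stages: stage zero is glued from \<open>X\<close> alone, and
  otherwise the chain of earlier stages is glued to the cells of all of them. A cell that was
  attached before is attached once more at each later stage, which does no harm.
\<close>

definition is_stage :: "('u, 'o, 'm) tower \<Rightarrow> 'u \<Rightarrow> 'o \<times> (('u, 'm) node \<Rightarrow> 'm) \<times> 'm \<Rightarrow> bool" where
  "is_stage F a = (\<lambda>(Z, c, p).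
     is_glue E (nodes F a) (node_obj F) (node_rels F a) Z c \<and>
     p \<in> Hom E Z Y \<and> (\<forall>n\<in>nodes F a. p \<odot>\<^bsub>E\<^esub> c n = node_proj F n))"

lemma f_Hom: "f \<in> Hom E X Y"
  by (rule in_Hom[OF f])

lemma \<theta>_trans: "(a, b) \<in> \<theta> \<Longrightarrow> (b, c) \<in> \<theta> \<Longrightarrow> (a, c) \<in> \<theta>"
  and \<theta>_antisym: "(a, b) \<in> \<theta> \<Longrightarrow> (b, a) \<in> \<theta> \<Longrightarrow> a = b"
  and \<theta>_total: "a \<in> Field \<theta> \<Longrightarrow> b \<in> Field \<theta> \<Longrightarrow> a \<noteq> b \<Longrightarrow> (a, b) \<in> \<theta> \<or> (b, a) \<in> \<theta>"
  and \<theta>_po: "partial_order_on (Field \<theta>) \<theta>"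
  and \<theta>_wf: "wf (\<theta> - Id)"
  using regular_cardinal_well_order[OF \<theta>(1)]
  unfolding well_order_on_def linear_order_on_def partial_order_on_def preorder_on_def total_on_def
  by (auto dest: transD antisymD)

lemma underS_trans: "c \<in> underS \<theta> b \<Longrightarrow> b \<in> underS \<theta> a \<Longrightarrow> c \<in> underS \<theta> a"
  unfolding underS_def using \<theta>_trans \<theta>_antisym by blast

lemma small_Field: "small \<kappa> (Field \<theta>)"
  using \<theta> unfolding small_def regular_cardinal_def
  by (simp add: ordIso_ordLess_trans[OF card_of_Field_ordIso])

lemma small_underS: "small \<kappa> (underS \<theta> a)"
  by (rule small_subset[OF _ small_Field]) (auto simp: underS_def Field_def)

text \<open>
  This locality is what makes the condition fit for well-founded recursion along \<open>\<theta>\<close>.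
\<close>

lemma is_stage_local:
  assumes FG: "\<And>b. b \<in> underS \<theta> a \<Longrightarrow> F b = G b"
  shows "is_stage F a s \<longleftrightarrow> is_stage G a s"
proof -
  have N: "nodes F a = nodes G a"
    unfolding nodes_def using FG by (intro arg_cong2[where f = "(\<union>)"] refl Collect_cong) auto
  have R: "node_rels F a = node_rels G a"
    unfolding node_rels_def N using FG underS_trans
    by (intro arg_cong2[where f = "(\<union>)"] refl Collect_cong) (metis (no_types, lifting))+
  have eq: "node_obj F n = node_obj G n" "node_proj F n = node_proj G n" if "n \<in> nodes G a" for n
    using that FG unfolding nodes_def by auto
  have "is_glue E (nodes G a) (node_obj F) (node_rels G a) Z c \<longleftrightarrow>
      is_glue E (nodes G a) (node_obj G) (node_rels G a) Z c" for Z c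
    by (rule is_glue_cong[OF eq(1)])
  then show ?thesis
    unfolding is_stage_def N R using eq(2) by (auto split: prod.splits)
qed

lemma Base_node: "Base \<in> nodes F b"
  and Stage_node: "c \<in> underS \<theta> b \<Longrightarrow> Stage c \<in> nodes F b"
  unfolding nodes_def by auto

lemma is_stageD:
  assumes "is_stage F b (F b)"
  shows "is_glue E (nodes F b) (node_obj F) (node_rels F b) (carrier F b) (incl F b)"
    and "proj F b \<in> Hom E (carrier F b) Y"
    and "n \<in> nodes F b \<Longrightarrow> proj F b \<odot>\<^bsub>E\<^esub> incl F b n = node_proj F n"
    and "carrier F b \<in> Obj E"
    and "n \<in> nodes F b \<Longrightarrow> incl F b n \<in> Hom E (node_obj F n) (carrier F b)"
    and "(n, g, n', g') \<in> node_rels F b \<Longrightarrow> incl F b n \<odot>\<^bsub>E\<^esub> g = incl F b n' \<odot>\<^bsub>E\<^esub> g'"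
proof -
  show glue: "is_glue E (nodes F b) (node_obj F) (node_rels F b) (carrier F b) (incl F b)"
    and "proj F b \<in> Hom E (carrier F b) Y"
    and "n \<in> nodes F b \<Longrightarrow> proj F b \<odot>\<^bsub>E\<^esub> incl F b n = node_proj F n"
    using assms unfolding is_stage_def by (auto split: prod.splits)
  show "carrier F b \<in> Obj E"
    and "n \<in> nodes F b \<Longrightarrow> incl F b n \<in> Hom E (node_obj F n) (carrier F b)"
    and "(n, g, n', g') \<in> node_rels F b \<Longrightarrow> incl F b n \<odot>\<^bsub>E\<^esub> g = incl F b n' \<odot>\<^bsub>E\<^esub> g'"
    using is_glue_cocone[OF glue] by blast+
qed

lemma glue_diagram_stage:
  assumes F: "\<And>b. b \<in> underS \<theta> a \<Longrightarrow> is_stage F b (F b)"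
  shows "glue_diagram E (nodes F a) (node_obj F) (node_rels F a)"
proof -
  note carrier = is_stageD(4)[OF F]
  have SO: "i \<in> S \<Longrightarrow> Dom E i \<in> Obj E" "i \<in> S \<Longrightarrow> Cod E i \<in> Obj E" for i
    using S Dom_Obj Cod_Obj by auto
  have XO: "X \<in> Obj E" "Y \<in> Obj E" using f Dom_Obj Cod_Obj by auto
  show "glue_diagram E (nodes F a) (node_obj F) (node_rels F a)"
    unfolding glue_diagram_def
  proof (intro conjI ballI)
    show "node_obj F n \<in> Obj E" if "n \<in> nodes F a" for n
      using that XO carrier SO unfolding nodes_def by auto
    show "case x of (n, g, n', g') \<Rightarrow> n \<in> nodes F a \<and> n' \<in> nodes F a \<and>
        (\<exists>K. g \<in> Hom E K (node_obj F n) \<and> g' \<in> Hom E K (node_obj F n'))"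
      if "x \<in> node_rels F a" for x
      using that unfolding node_rels_def
    proof (elim UnE CollectE exE conjE)
      fix b assume "x = (Base, Idn E X, Stage b, incl F b Base)" "b \<in> underS \<theta> a"
      then show ?thesis
        using Base_node Stage_node Idn_Hom[OF XO(1)] is_stageD(5)[OF F Base_node] by auto
    next
      fix b b' assume x: "x = (Stage b', Idn E (carrier F b'), Stage b, incl F b (Stage b'))"
        and b: "b \<in> underS \<theta> a" "b' \<in> underS \<theta> b"
      note b' = underS_trans[OF b(2,1)]
      show ?thesis
        using b b' Stage_node Idn_Hom[OF carrier[OF b']] is_stageD(5)[OF F[OF b(1)] Stage_node[OF b(2)]]
        unfolding x by auto
    next
      fix b i u v assume x: "x = (Stage b, u, Cell b i u v, i)" and c: "Cell b i u v \<in> nodes F a"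
      then have "b \<in> underS \<theta> a" "u \<in> Hom E (Dom E i) (carrier F b)" "i \<in> S"
        unfolding nodes_def by auto
      moreover from this have "i \<in> Hom E (Dom E i) (Cod E i)"
        using S in_Hom by blast
      ultimately show ?thesis
        unfolding x using c Stage_node by auto
    qed
  qed
qed

text \<open>
  The nodes are few because \<open>E\<close> is locally small. The projections of the earlier stages, together with
  the lower sides of the squares on the cells, form a cocone with vertex \<open>Y\<close>; it induces the new projection.
\<close>

lemma stage_exists:
  assumes F: "\<And>b. b \<in> underS \<theta> a \<Longrightarrow> is_stage F b (F b)"
  shows "\<exists>s. is_stage F a s"
proof -
  note p = is_stageD(2)[OF F]
  note p_incl = is_stageD(3)[OF F]
  note carrier = is_stageD(4)[OF F]
  let ?cells = "SIGMA bi : underS \<theta> a \<times> S.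
    Hom E (Dom E (snd bi)) (carrier F (fst bi)) \<times> Hom E (Cod E (snd bi)) Y"
  have SO: "i \<in> S \<Longrightarrow> Dom E i \<in> Obj E" "i \<in> S \<Longrightarrow> Cod E i \<in> Obj E" for i
    using S Dom_Obj Cod_Obj by auto
  have loc: "small \<kappa> (Hom E A B)" if "A \<in> Obj E" "B \<in> Obj E" for A B
    using presentable that unfolding locally_presentable_def locally_small_def by blast
  have cells: "small \<kappa> ?cells"
    using S(2) small_underS carrier SO Cod_Obj[OF f]
    by (intro small_Sigma loc) auto
  have "nodes F a \<subseteq> {Base} \<union> Stage ` underS \<theta> a \<union> (\<lambda>((b, i), u, v). Cell b i u v) ` ?cells"
    unfolding nodes_def by (force simp: image_iff)
  then have N: "small \<kappa> (nodes F a)"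
    by (rule small_subset) (intro small_Un small_image cells small_underS small_finite; simp)
  have "node_rels F a \<subseteq>
      (\<lambda>b. (Base, Idn E X, Stage b, incl F b Base)) ` underS \<theta> a \<union>
      (\<lambda>(b, b'). (Stage b', Idn E (carrier F b'), Stage b, incl F b (Stage b'))) `
        (SIGMA b : underS \<theta> a. underS \<theta> b) \<union>
      (\<lambda>n. case n of Cell b i u v \<Rightarrow> (Stage b, u, Cell b i u v, i)) ` nodes F a"
    unfolding node_rels_def by (force simp: image_iff)
  then have R: "small \<kappa> (node_rels F a)"
    by (rule small_subset) (intro small_Un small_image N small_underS small_Sigma)
  then obtain Z c where Zc: "is_glue E (nodes F a) (node_obj F) (node_rels F a) Z c"
    using glue_exists[OF N R glue_diagram_stage[OF F]] by blast
  have "glue_cocone E (nodes F a) (node_obj F) (node_rels F a) Y (node_proj F)"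
    unfolding glue_cocone_def
  proof (intro conjI ballI)
    show "Y \<in> Obj E" using f Cod_Obj by blast
    show "node_proj F n \<in> Hom E (node_obj F n) Y" if "n \<in> nodes F a" for n
      using that f_Hom p unfolding nodes_def by auto
    show "case x of (n, g, n', g') \<Rightarrow> node_proj F n \<odot>\<^bsub>E\<^esub> g = node_proj F n' \<odot>\<^bsub>E\<^esub> g'"
      if "x \<in> node_rels F a" for x
      using that unfolding node_rels_def
    proof (elim UnE CollectE exE conjE)
      fix b assume "x = (Base, Idn E X, Stage b, incl F b Base)" "b \<in> underS \<theta> a"
      then show ?thesis
        using p_incl[OF _ Base_node] Cmp_Idn[OF f_Hom] by auto
    next
      fix b b' assume x: "x = (Stage b', Idn E (carrier F b'), Stage b, incl F b (Stage b'))"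
        and b: "b \<in> underS \<theta> a" "b' \<in> underS \<theta> b"
      show ?thesis
        using p_incl[OF b(1) Stage_node[OF b(2)]] Cmp_Idn[OF p[OF underS_trans[OF b(2,1)]]]
        unfolding x by auto
    next
      fix b i u v assume x: "x = (Stage b, u, Cell b i u v, i)" and c: "Cell b i u v \<in> nodes F a"
      then show ?thesis
        unfolding x nodes_def by auto
    qed
  qed
  with Zc obtain q where "q \<in> Hom E Z Y" "\<And>n. n \<in> nodes F a \<Longrightarrow> q \<odot>\<^bsub>E\<^esub> c n = node_proj F n"
    by (rule is_glue_induce) blast
  then have "is_stage F a (Z, c, q)"
    unfolding is_stage_def using Zc by blast
  then show ?thesis ..
qed

lemma tower_exists: "\<exists>F. \<forall>a. is_stage F a (F a)"
proof (rule dependent_wf_choice[OF \<theta>_wf])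
  have u: "(b, a) \<in> \<theta> - Id \<longleftrightarrow> b \<in> underS \<theta> a" for a b
    unfolding underS_def by auto
  show "is_stage F a s = is_stage G a s" if "\<And>b. (b, a) \<in> \<theta> - Id \<Longrightarrow> F b = G b" for F G a s
    using that unfolding u by (rule is_stage_local)
  show "\<exists>s. is_stage F a s" if "\<And>b. (b, a) \<in> \<theta> - Id \<Longrightarrow> is_stage F b (F b)" for a F
    using that unfolding u by (rule stage_exists)
qed

end

locale cell_tower = small_object_argument \<kappa> E \<theta> S f
  for \<kappa> :: "'u rel" and E :: "('o, 'm) cat" and \<theta> S f +
  fixes F :: "('u, 'o, 'm) tower"
  assumes stage: "\<And>a. is_stage F a (F a)"
begin

lemmas glue = is_stageD(1)[OF stage]
  and proj_Hom = is_stageD(2)[OF stage]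
  and proj_incl = is_stageD(3)[OF stage]
  and incl_Hom = is_stageD(5)[OF stage]
  and incl_rel = is_stageD(6)[OF stage]
  and diagram = glue_diagram_stage[OF stage]

lemma carrier_Obj: "carrier F a \<in> Obj E"
  by (rule is_stageD(4)[OF stage])

lemma incl_Base_Hom: "incl F a Base \<in> Hom E X (carrier F a)"
  using incl_Hom[OF Base_node] by simp

lemma incl_Stage_Hom: "b \<in> underS \<theta> a \<Longrightarrow> incl F a (Stage b) \<in> Hom E (carrier F b) (carrier F a)"
  using incl_Hom[OF Stage_node] by simp

lemma proj_Base: "proj F a \<odot>\<^bsub>E\<^esub> incl F a Base = f"
  using proj_incl[OF Base_node] by simp

lemma proj_Stage: "b \<in> underS \<theta> a \<Longrightarrow> proj F a \<odot>\<^bsub>E\<^esub> incl F a (Stage b) = proj F b"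
  using proj_incl[OF Stage_node] by simp

lemma incl_Stage_Base:
  assumes b: "b \<in> underS \<theta> a"
  shows "incl F a (Stage b) \<odot>\<^bsub>E\<^esub> incl F b Base = incl F a Base"
proof -
  have "incl F a Base \<odot>\<^bsub>E\<^esub> Idn E X = incl F a (Stage b) \<odot>\<^bsub>E\<^esub> incl F b Base"
    by (rule incl_rel) (use b in \<open>auto simp: node_rels_def\<close>)
  then show ?thesis using Cmp_Idn[OF incl_Base_Hom] by simp
qed

lemma incl_Stage_Stage:
  assumes b: "b \<in> underS \<theta> a" "b' \<in> underS \<theta> b"
  shows "incl F a (Stage b) \<odot>\<^bsub>E\<^esub> incl F b (Stage b') = incl F a (Stage b')"
proof -
  have "incl F a (Stage b') \<odot>\<^bsub>E\<^esub> Idn E (carrier F b') = incl F a (Stage b) \<odot>\<^bsub>E\<^esub> incl F b (Stage b')"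
    by (rule incl_rel) (use b in \<open>auto simp: node_rels_def\<close>)
  then show ?thesis using Cmp_Idn[OF incl_Stage_Hom[OF underS_trans[OF b(2,1)]]] by simp
qed

lemma cell_node:
  assumes "Cell b i u v \<in> nodes F a"
  shows "b \<in> underS \<theta> a" "i \<in> S" "u \<in> Hom E (Dom E i) (carrier F b)" "v \<in> Hom E (Cod E i) Y"
    "proj F b \<odot>\<^bsub>E\<^esub> u = v \<odot>\<^bsub>E\<^esub> i" "incl F a (Cell b i u v) \<in> Hom E (Cod E i) (carrier F a)"
    "incl F a (Stage b) \<odot>\<^bsub>E\<^esub> u = incl F a (Cell b i u v) \<odot>\<^bsub>E\<^esub> i"
    "proj F a \<odot>\<^bsub>E\<^esub> incl F a (Cell b i u v) = v"
proof -
  show "b \<in> underS \<theta> a" "i \<in> S" "u \<in> Hom E (Dom E i) (carrier F b)" "v \<in> Hom E (Cod E i) Y"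
    "proj F b \<odot>\<^bsub>E\<^esub> u = v \<odot>\<^bsub>E\<^esub> i"
    using assms unfolding nodes_def by auto
  show "incl F a (Cell b i u v) \<in> Hom E (Cod E i) (carrier F a)"
    using incl_Hom[OF assms] by simp
  show "incl F a (Stage b) \<odot>\<^bsub>E\<^esub> u = incl F a (Cell b i u v) \<odot>\<^bsub>E\<^esub> i"
    by (rule incl_rel) (use assms in \<open>auto simp: node_rels_def\<close>)
  show "proj F a \<odot>\<^bsub>E\<^esub> incl F a (Cell b i u v) = v"
    using proj_incl[OF assms] by simp
qed

definition chain :: "('u, 'u \<times> 'u, 'o, 'm) cfunctor" where
  "chain = \<lparr>omap = carrier F,
     amap = (\<lambda>(b, a). if b = a then Idn E (carrier F a) else incl F a (Stage b))\<rparr>"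

lemma chain_functor: "is_functor (poset_cat (Field \<theta>) \<theta>) E chain"
  unfolding is_functor_def poset_cat_simps
proof (intro conjI ballI impI)
  have in_underS: "(b, a) \<in> \<theta> \<Longrightarrow> b \<noteq> a \<Longrightarrow> b \<in> underS \<theta> a" for a b
    by (simp add: underS_def)
  show "omap chain a \<in> Obj E" for a
    using carrier_Obj by (simp add: chain_def)
  show "amap chain (a, a) = Idn E (omap chain a)" for a
    by (simp add: chain_def)
  show "amap chain e \<in> Hom E (omap chain (fst e)) (omap chain (snd e))" if "e \<in> \<theta>" for e
    using that Idn_Hom[OF carrier_Obj] incl_Stage_Hom[OF in_underS]
    by (cases e) (simp add: chain_def)
  show "amap chain (fst d, snd e) = amap chain e \<odot>\<^bsub>E\<^esub> amap chain d"
    if "d \<in> \<theta>" "e \<in> \<theta>" "snd d = fst e" for d e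
  proof -
    obtain x y z where e: "d = (x, y)" "e = (y, z)" "(x, y) \<in> \<theta>" "(y, z) \<in> \<theta>"
      using \<open>d \<in> \<theta>\<close> \<open>e \<in> \<theta>\<close> \<open>snd d = fst e\<close> by (metis prod.collapse)
    consider "x = y" "y = z" | "x = y" "y \<noteq> z" | "x \<noteq> y" "y = z" | "x \<noteq> y" "y \<noteq> z" "x \<noteq> z"
      using \<theta>_antisym e by blast
    then show ?thesis
    proof cases
      case 1
      then show ?thesis using Cmp_Idn[OF Idn_Hom[OF carrier_Obj]] by (simp add: e chain_def)
    next
      case 2
      then show ?thesis using Cmp_Idn[OF incl_Stage_Hom[OF in_underS]] e by (simp add: e chain_def)
    next
      case 3
      then show ?thesis using Idn_Cmp[OF incl_Stage_Hom[OF in_underS]] e by (simp add: e chain_def)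
    next
      case 4
      then show ?thesis using incl_Stage_Stage[OF in_underS in_underS] e by (simp add: e chain_def)
    qed
  qed
qed

lemma chain_cocone_iff:
  "is_cocone E (poset_cat (Field \<theta>) \<theta>) chain M d \<longleftrightarrow>
     M \<in> Obj E \<and> (\<forall>a\<in>Field \<theta>. d a \<in> Hom E (carrier F a) M) \<and>
     (\<forall>a\<in>Field \<theta>. \<forall>b\<in>underS \<theta> a. d a \<odot>\<^bsub>E\<^esub> incl F a (Stage b) = d b)" (is "?l \<longleftrightarrow> ?r")
proof
  assume ?l
  show ?r
  proof (intro conjI ballI)
    fix a b assume "a \<in> Field \<theta>" "b \<in> underS \<theta> a"
    then show "d a \<odot>\<^bsub>E\<^esub> incl F a (Stage b) = d b"
      using poset_cocone(2)[OF \<open>?l\<close>, of b a] by (simp add: underS_def chain_def)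
  qed (use \<open>?l\<close> in \<open>auto simp: is_cocone_def poset_cat_simps chain_def\<close>)
next
  assume ?r
  then have d: "a \<in> Field \<theta> \<Longrightarrow> d a \<in> Hom E (carrier F a) M" for a by blast
  have "d (snd e) \<odot>\<^bsub>E\<^esub> amap chain e = d (fst e)" if "e \<in> \<theta>" for e
  proof -
    obtain b a where e: "e = (b, a)" "(b, a) \<in> \<theta>" using \<open>e \<in> \<theta>\<close> by (cases e) auto
    then have a: "a \<in> Field \<theta>" by (auto simp: Field_def)
    show ?thesis
    proof (cases "b = a")
      case True
      then show ?thesis using Cmp_Idn[OF d[OF a]] e by (simp add: chain_def)
    next
      case False
      then have "b \<in> underS \<theta> a" using e by (simp add: underS_def)
      then show ?thesis using \<open>?r\<close> a False e by (simp add: chain_def)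
    qed
  qed
  then show ?l using \<open>?r\<close> by (auto simp: is_cocone_def poset_cat_simps chain_def)
qed

text \<open>
  The extension is glued from \<open>u\<close>, the given lifts on earlier stages, and a lift on each cell. The
  last one exists because the cell is attached along some \<open>i \<in> S\<close>, against which \<open>g\<close> has the right
  lifting property. Both triangles of the lifting problem commute because they do so on each node.
\<close>

lemma lift_extends_to_stage:
  assumes g: "g \<in> rlp E S" and w: "w \<in> Hom E (carrier F a) (Cod E g)"
    and u: "u \<in> Hom E X (Dom E g)" "g \<odot>\<^bsub>E\<^esub> u = w \<odot>\<^bsub>E\<^esub> incl F a Base"
    and h: "\<And>b. b \<in> underS \<theta> a \<Longrightarrow> h b \<in> Hom E (carrier F b) (Dom E g)"
      "\<And>b. b \<in> underS \<theta> a \<Longrightarrow> g \<odot>\<^bsub>E\<^esub> h b = w \<odot>\<^bsub>E\<^esub> incl F a (Stage b)"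
      "\<And>b. b \<in> underS \<theta> a \<Longrightarrow> h b \<odot>\<^bsub>E\<^esub> incl F b Base = u"
      "\<And>b b'. b \<in> underS \<theta> a \<Longrightarrow> b' \<in> underS \<theta> b \<Longrightarrow>
         h b \<odot>\<^bsub>E\<^esub> incl F b (Stage b') = h b'"
  shows "\<exists>k\<in>Hom E (carrier F a) (Dom E g). g \<odot>\<^bsub>E\<^esub> k = w \<and> k \<odot>\<^bsub>E\<^esub> incl F a Base = u \<and>
           (\<forall>b\<in>underS \<theta> a. k \<odot>\<^bsub>E\<^esub> incl F a (Stage b) = h b)"
proof -
  have g': "g \<in> Hom E (Dom E g) (Cod E g)" using g in_Hom unfolding rlp_def by blast
  have "\<exists>e. e \<in> Hom E (Cod E i) (Dom E g) \<and> e \<odot>\<^bsub>E\<^esub> i = h b \<odot>\<^bsub>E\<^esub> p \<and>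
      g \<odot>\<^bsub>E\<^esub> e = w \<odot>\<^bsub>E\<^esub> incl F a (Cell b i p q)"
    if cell: "Cell b i p q \<in> nodes F a" for b i p q
  proof -
    note cell' = cell_node[OF cell]
    have i: "i \<in> Hom E (Dom E i) (Cod E i)" using S cell'(2) in_Hom by blast
    have "g \<odot>\<^bsub>E\<^esub> (h b \<odot>\<^bsub>E\<^esub> p) = (w \<odot>\<^bsub>E\<^esub> incl F a (Stage b)) \<odot>\<^bsub>E\<^esub> p"
      using Cmp_assoc[OF cell'(3) h(1)[OF cell'(1)] g'] h(2)[OF cell'(1)] by simp
    also have "\<dots> = w \<odot>\<^bsub>E\<^esub> (incl F a (Stage b) \<odot>\<^bsub>E\<^esub> p)"
      using Cmp_assoc[OF cell'(3) incl_Stage_Hom[OF cell'(1)] w] by simp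
    also have "\<dots> = (w \<odot>\<^bsub>E\<^esub> incl F a (Cell b i p q)) \<odot>\<^bsub>E\<^esub> i"
      using Cmp_assoc[OF i cell'(6) w] cell'(7) by simp
    finally have "g \<odot>\<^bsub>E\<^esub> (h b \<odot>\<^bsub>E\<^esub> p) =
      (w \<odot>\<^bsub>E\<^esub> incl F a (Cell b i p q)) \<odot>\<^bsub>E\<^esub> i" .
    moreover have "lifts E i g" using g cell'(2) unfolding rlp_def by blast
    ultimately show ?thesis
      using Cmp_Hom[OF cell'(3) h(1)[OF cell'(1)]] Cmp_Hom[OF cell'(6) w]
      unfolding lifts_def by blast
  qed
  then obtain e where e: "e b i p q \<in> Hom E (Cod E i) (Dom E g)"
      "e b i p q \<odot>\<^bsub>E\<^esub> i = h b \<odot>\<^bsub>E\<^esub> p"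
      "g \<odot>\<^bsub>E\<^esub> e b i p q = w \<odot>\<^bsub>E\<^esub> incl F a (Cell b i p q)"
    if "Cell b i p q \<in> nodes F a" for b i p q
    by metis
  define d where "d n = (case n of Base \<Rightarrow> u | Stage b \<Rightarrow> h b | Cell b i p q \<Rightarrow> e b i p q)" for n
  have "glue_cocone E (nodes F a) (node_obj F) (node_rels F a) (Dom E g) d"
    unfolding glue_cocone_def
  proof (intro conjI ballI)
    show "Dom E g \<in> Obj E" using Hom_Obj[OF g'] by blast
    show "d n \<in> Hom E (node_obj F n) (Dom E g)" if n: "n \<in> nodes F a" for n
    proof (cases n)
      case (Stage b)
      then have "b \<in> underS \<theta> a" using n unfolding nodes_def by auto
      then show ?thesis using h(1) Stage by (simp add: d_def)
    next
      case (Cell b i p q)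
      then show ?thesis using e(1) n by (simp add: d_def)
    qed (simp add: d_def u(1))
    show "case x of (n, k, n', k') \<Rightarrow> d n \<odot>\<^bsub>E\<^esub> k = d n' \<odot>\<^bsub>E\<^esub> k'"
      if "x \<in> node_rels F a" for x
      using that unfolding node_rels_def
    proof (elim UnE CollectE exE conjE)
      fix b assume "x = (Base, Idn E X, Stage b, incl F b Base)" "b \<in> underS \<theta> a"
      then show ?thesis using h(3) Cmp_Idn[OF u(1)] by (simp add: d_def)
    next
      fix b b' assume "x = (Stage b', Idn E (carrier F b'), Stage b, incl F b (Stage b'))"
        and b: "b \<in> underS \<theta> a" "b' \<in> underS \<theta> b"
      then show ?thesis
        using h(4) Cmp_Idn[OF h(1)[OF underS_trans[OF b(2,1)]]] by (simp add: d_def)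
    next
      fix b i p q assume "x = (Stage b, p, Cell b i p q, i)" "Cell b i p q \<in> nodes F a"
      then show ?thesis using e(2) by (simp add: d_def)
    qed
  qed
  then obtain k where k: "k \<in> Hom E (carrier F a) (Dom E g)"
    and kd: "\<And>n. n \<in> nodes F a \<Longrightarrow> k \<odot>\<^bsub>E\<^esub> incl F a n = d n"
    using is_glue_induce[OF glue] by metis
  have "g \<odot>\<^bsub>E\<^esub> k = w"
  proof (rule is_glue_unique[OF glue Cmp_Hom[OF k g'] w _ diagram])
    fix n assume n: "n \<in> nodes F a"
    have "g \<odot>\<^bsub>E\<^esub> d n = w \<odot>\<^bsub>E\<^esub> incl F a n"
    proof (cases n)
      case Base
      then show ?thesis
        using u(2) by (simp add: d_def)
    next
      case (Stage b)
      then have b: "b \<in> underS \<theta> a" using n unfolding nodes_def by auto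
      then show ?thesis
        using h(2)[OF b] Stage by (simp add: d_def)
    next
      case (Cell b i p q)
      then show ?thesis using e(3) n by (simp add: d_def)
    qed
    then show "(g \<odot>\<^bsub>E\<^esub> k) \<odot>\<^bsub>E\<^esub> incl F a n = w \<odot>\<^bsub>E\<^esub> incl F a n"
      using Cmp_assoc[OF incl_Hom[OF n] k g'] kd[OF n] by simp
  qed
  then show ?thesis
    using k kd[OF Base_node] kd[OF Stage_node] by (auto simp: d_def)
qed

end

section \<open>The factorization through the colimit of a tower\<close>

locale cell_tower_colimit = cell_tower \<kappa> E \<theta> S f F
  for \<kappa> :: "'u rel" and E :: "('o, 'm) cat" and \<theta> S f F +
  fixes L c
  assumes colimit: "is_colimit E (poset_cat (Field \<theta>) \<theta>) chain L c"
begin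

lemma coproj_Hom: "a \<in> Field \<theta> \<Longrightarrow> c a \<in> Hom E (carrier F a) L"
  and coproj_incl: "a \<in> Field \<theta> \<Longrightarrow> b \<in> underS \<theta> a \<Longrightarrow> c a \<odot>\<^bsub>E\<^esub> incl F a (Stage b) = c b"
  using colimit unfolding is_colimit_def chain_cocone_iff by blast+

lemma colimit_induce:
  assumes "M \<in> Obj E" "\<And>a. a \<in> Field \<theta> \<Longrightarrow> d a \<in> Hom E (carrier F a) M"
    "\<And>a b. a \<in> Field \<theta> \<Longrightarrow> b \<in> underS \<theta> a \<Longrightarrow> d a \<odot>\<^bsub>E\<^esub> incl F a (Stage b) = d b"
  shows "\<exists>h\<in>Hom E L M. \<forall>a\<in>Field \<theta>. h \<odot>\<^bsub>E\<^esub> c a = d a"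
proof -
  have "is_cocone E (poset_cat (Field \<theta>) \<theta>) chain M d"
    unfolding chain_cocone_iff using assms by blast
  then show ?thesis using colimit unfolding is_colimit_def poset_cat_simps by blast
qed

lemma colimit_unique:
  assumes "h \<in> Hom E L M" "h' \<in> Hom E L M"
    "\<And>a. a \<in> Field \<theta> \<Longrightarrow> h \<odot>\<^bsub>E\<^esub> c a = h' \<odot>\<^bsub>E\<^esub> c a"
  shows "h = h'"
  using is_colimit_unique[OF colimit assms(1,2) _ category_poset_cat[OF \<theta>_po] chain_functor]
    assms(3)
  by (simp add: poset_cat_simps)

lemma chain_length: "infinite (Field \<theta>)" "Card_order \<theta>"
  using \<theta>(1) unfolding regular_cardinal_def cinfinite_def by auto

lemma base_map_exists: "\<exists>l\<in>Hom E X L. \<forall>a\<in>Field \<theta>. c a \<odot>\<^bsub>E\<^esub> incl F a Base = l"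
proof -
  obtain z where z: "z \<in> Field \<theta>" using chain_length(1) by (metis all_not_in_conv finite.emptyI)
  have l_lower: "c a \<odot>\<^bsub>E\<^esub> incl F a Base = c b \<odot>\<^bsub>E\<^esub> incl F b Base"
    if "a \<in> Field \<theta>" "b \<in> underS \<theta> a" for a b
    using Cmp_assoc[OF incl_Base_Hom incl_Stage_Hom[OF that(2)] coproj_Hom[OF that(1)]]
      coproj_incl[OF that] incl_Stage_Base[OF that(2)] by simp
  have "c a \<odot>\<^bsub>E\<^esub> incl F a Base = c z \<odot>\<^bsub>E\<^esub> incl F z Base" if a: "a \<in> Field \<theta>" for a
  proof -
    consider "a = z" | "a \<in> underS \<theta> z" | "z \<in> underS \<theta> a"
      using \<theta>_total a z unfolding underS_def by blast
    then show ?thesis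
      using l_lower a z by cases auto
  qed
  then show ?thesis
    using Cmp_Hom[OF incl_Base_Hom coproj_Hom[OF z]] by blast
qed

text \<open>
  Smallness of the domain of \<open>i\<close> turns a lifting problem against \<open>r\<close> into one against the projection
  of a stage \<open>b\<close>. For the latter a cell is present in all stages after \<open>b\<close>, of which there is at
  least one because \<open>\<theta>\<close> is a limit ordinal. The coprojection of that cell is the lift.
\<close>

lemma projection_has_rlp:
  assumes r: "r \<in> Hom E L Y" and rc: "\<And>a. a \<in> Field \<theta> \<Longrightarrow> r \<odot>\<^bsub>E\<^esub> c a = proj F a"
  shows "r \<in> rlp E S"
proof -
  have "lifts E i r" if i: "i \<in> S" for i
    unfolding lifts_def Hom_Dom[OF r] Hom_Cod[OF r]
  proof (intro ballI impI)
    fix u v assume u: "u \<in> Hom E (Dom E i) L" and v: "v \<in> Hom E (Cod E i) Y"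
      and sq: "r \<odot>\<^bsub>E\<^esub> u = v \<odot>\<^bsub>E\<^esub> i"
    have i': "i \<in> Hom E (Dom E i) (Cod E i)" using S i in_Hom by blast
    obtain b u' where b: "b \<in> Field \<theta>" and "u' \<in> Hom E (Dom E i) (omap chain b)"
      and u'c: "c b \<odot>\<^bsub>E\<^esub> u' = u"
      using small_dom[OF i] chain_functor colimit u unfolding small_for_chains_def by blast
    then have u': "u' \<in> Hom E (Dom E i) (carrier F b)" by (simp add: chain_def)
    obtain a where a: "a \<in> Field \<theta>" "b \<in> underS \<theta> a"
      using infinite_Card_order_limit[OF chain_length(2,1) b] unfolding underS_def by auto
    have "proj F b \<odot>\<^bsub>E\<^esub> u' = v \<odot>\<^bsub>E\<^esub> i"
      using Cmp_assoc[OF u' coproj_Hom[OF b] r] rc[OF b] u'c sq by simp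
    then have cell: "Cell b i u' v \<in> nodes F a"
      unfolding nodes_def using a i u' v by blast
    note cell' = cell_node[OF cell]
    let ?h = "c a \<odot>\<^bsub>E\<^esub> incl F a (Cell b i u' v)"
    have "?h \<in> Hom E (Cod E i) L"
      using Cmp_Hom[OF cell'(6) coproj_Hom[OF a(1)]] .
    moreover have "?h \<odot>\<^bsub>E\<^esub> i = u"
      using Cmp_assoc[OF i' cell'(6) coproj_Hom[OF a(1)]] cell'(7)
        Cmp_assoc[OF u' incl_Stage_Hom[OF a(2)] coproj_Hom[OF a(1)]] coproj_incl[OF a] u'c by simp
    moreover have "r \<odot>\<^bsub>E\<^esub> ?h = v"
      using Cmp_assoc[OF cell'(6) coproj_Hom[OF a(1)] r] rc[OF a(1)] cell'(8) by simp
    ultimately show "\<exists>h\<in>Hom E (Cod E i) L. h \<odot>\<^bsub>E\<^esub> i = u \<and> r \<odot>\<^bsub>E\<^esub> h = v"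
      by blast
  qed
  then show ?thesis
    unfolding rlp_def using Hom_Arr[OF r] by blast
qed

text \<open>
  Lifts on the stages must be chosen compatibly, so they are chosen by recursion: each one extends
  all the earlier ones. Together they form a cocone, which induces the lift on \<open>L\<close>.
\<close>

lemma base_map_has_llp:
  assumes l: "l \<in> Hom E X L" and l_eq: "\<And>a. a \<in> Field \<theta> \<Longrightarrow> c a \<odot>\<^bsub>E\<^esub> incl F a Base = l"
  shows "l \<in> llp E (rlp E S)"
proof -
  obtain z where z: "z \<in> Field \<theta>" using chain_length(1) by (metis all_not_in_conv finite.emptyI)
  have "lifts E l g" if g: "g \<in> rlp E S" for g
    unfolding lifts_def Hom_Dom[OF l] Hom_Cod[OF l]
  proof (intro ballI impI)
    fix u v assume u: "u \<in> Hom E X (Dom E g)" and v: "v \<in> Hom E L (Cod E g)"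
      and sq: "g \<odot>\<^bsub>E\<^esub> u = v \<odot>\<^bsub>E\<^esub> l"
    have g': "g \<in> Hom E (Dom E g) (Cod E g)" using g in_Hom unfolding rlp_def by blast
    \<comment> \<open>The recursion runs over the whole type \<open>'u\<close>; outside the index set any value will do.\<close>
    define lift where "lift h a k \<longleftrightarrow> (a \<in> Field \<theta> \<longrightarrow>
        k \<in> Hom E (carrier F a) (Dom E g) \<and> g \<odot>\<^bsub>E\<^esub> k = v \<odot>\<^bsub>E\<^esub> c a \<and> k \<odot>\<^bsub>E\<^esub> incl F a Base = u \<and>
        (\<forall>b\<in>underS \<theta> a. k \<odot>\<^bsub>E\<^esub> incl F a (Stage b) = h b))" for h a k
    have "\<exists>h. \<forall>a. lift h a (h a)"
    proof (rule dependent_wf_choice[OF \<theta>_wf])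
      have U: "(b, a) \<in> \<theta> - Id \<longleftrightarrow> b \<in> underS \<theta> a" for a b
        unfolding underS_def by auto
      show "lift h a k = lift h' a k" if "\<And>b. (b, a) \<in> \<theta> - Id \<Longrightarrow> h b = h' b" for h h' a k
        using that unfolding U lift_def by simp
      show "\<exists>k. lift h a k" if h: "\<And>b. (b, a) \<in> \<theta> - Id \<Longrightarrow> lift h b (h b)" for a h
      proof (cases "a \<in> Field \<theta>")
        case False
        then show ?thesis unfolding lift_def by blast
      next
        case a: True
        have F: "b \<in> Field \<theta>" if "b \<in> underS \<theta> a" for b
          using that unfolding underS_def Field_def by auto
        have h: "h b \<in> Hom E (carrier F b) (Dom E g)" "g \<odot>\<^bsub>E\<^esub> h b = v \<odot>\<^bsub>E\<^esub> c b"
            "h b \<odot>\<^bsub>E\<^esub> incl F b Base = u"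
            "\<And>b'. b' \<in> underS \<theta> b \<Longrightarrow> h b \<odot>\<^bsub>E\<^esub> incl F b (Stage b') = h b'"
          if "b \<in> underS \<theta> a" for b
          using h[unfolded U, OF that] F[OF that] unfolding lift_def by auto
        have "g \<odot>\<^bsub>E\<^esub> u = (v \<odot>\<^bsub>E\<^esub> c a) \<odot>\<^bsub>E\<^esub> incl F a Base"
          using sq Cmp_assoc[OF incl_Base_Hom coproj_Hom[OF a] v] l_eq[OF a] by simp
        moreover have "g \<odot>\<^bsub>E\<^esub> h b = (v \<odot>\<^bsub>E\<^esub> c a) \<odot>\<^bsub>E\<^esub> incl F a (Stage b)"
          if b: "b \<in> underS \<theta> a" for b
          using h(2)[OF b] Cmp_assoc[OF incl_Stage_Hom[OF b] coproj_Hom[OF a] v] coproj_incl[OF a b] by simp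
        ultimately have "\<exists>k\<in>Hom E (carrier F a) (Dom E g). g \<odot>\<^bsub>E\<^esub> k = v \<odot>\<^bsub>E\<^esub> c a \<and>
            k \<odot>\<^bsub>E\<^esub> incl F a Base = u \<and> (\<forall>b\<in>underS \<theta> a. k \<odot>\<^bsub>E\<^esub> incl F a (Stage b) = h b)"
          using lift_extends_to_stage[OF g Cmp_Hom[OF coproj_Hom[OF a] v] u, of h] h(1,3,4) by simp
        then show ?thesis unfolding lift_def by blast
      qed
    qed
    then obtain h where h: "\<And>a. lift h a (h a)" by blast
    then obtain H where H: "H \<in> Hom E L (Dom E g)"
      and Hc: "\<And>a. a \<in> Field \<theta> \<Longrightarrow> H \<odot>\<^bsub>E\<^esub> c a = h a"
      using colimit_induce[of "Dom E g" h] Hom_Obj[OF g'] unfolding lift_def by blast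
    have "H \<odot>\<^bsub>E\<^esub> l = u"
      using l_eq[OF z] Cmp_assoc[OF incl_Base_Hom coproj_Hom[OF z] H] Hc[OF z] h[of z] z
      by (auto simp: lift_def)
    moreover have "g \<odot>\<^bsub>E\<^esub> H = v"
    proof (rule colimit_unique[OF Cmp_Hom[OF H g'] v])
      fix a assume a: "a \<in> Field \<theta>"
      then show "(g \<odot>\<^bsub>E\<^esub> H) \<odot>\<^bsub>E\<^esub> c a = v \<odot>\<^bsub>E\<^esub> c a"
        using Cmp_assoc[OF coproj_Hom[OF a] H g'] Hc[OF a] h[of a] by (simp add: lift_def)
    qed
    ultimately show "\<exists>h\<in>Hom E L (Dom E g). h \<odot>\<^bsub>E\<^esub> l = u \<and> g \<odot>\<^bsub>E\<^esub> h = v"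
      using H by blast
  qed
  then show ?thesis
    unfolding llp_def using Hom_Arr[OF l] by blast
qed

end

lemma (in small_object_argument) factorization_exists:
  "\<exists>l\<in>llp E (rlp E S). \<exists>r\<in>rlp E S. Cod E l = Dom E r \<and> r \<odot>\<^bsub>E\<^esub> l = f"
proof -
  obtain F where stage: "\<forall>a. is_stage F a (F a)"
    using tower_exists by blast
  interpret cell_tower \<kappa> E \<theta> S f F
    by unfold_locales (use stage in blast)
  have "\<theta> \<subseteq> Field \<theta> \<times> Field \<theta>" by (auto simp: Field_def)
  then have "small \<kappa> \<theta>"
    by (rule small_subset) (intro small_Sigma small_Field)
  then obtain L c where L: "is_colimit E (poset_cat (Field \<theta>) \<theta>) chain L c"
    using small_colimit_exists[OF category_poset_cat[OF \<theta>_po] _ _ chain_functor] small_Field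
    by (auto simp: poset_cat_simps)
  interpret cell_tower_colimit \<kappa> E \<theta> S f F L c
    by unfold_locales (rule L)
  obtain l where l: "l \<in> Hom E X L" and l_eq: "\<And>a. a \<in> Field \<theta> \<Longrightarrow> c a \<odot>\<^bsub>E\<^esub> incl F a Base = l"
    using base_map_exists by blast
  obtain r where r: "r \<in> Hom E L Y" and rc: "\<And>a. a \<in> Field \<theta> \<Longrightarrow> r \<odot>\<^bsub>E\<^esub> c a = proj F a"
    using colimit_induce[of Y "proj F"] Cod_Obj[OF f] proj_Hom proj_Stage by blast
  obtain z where z: "z \<in> Field \<theta>" using chain_length(1) by (metis all_not_in_conv finite.emptyI)
  have "r \<odot>\<^bsub>E\<^esub> l = f"
    using l_eq[OF z] Cmp_assoc[OF incl_Base_Hom coproj_Hom[OF z] r] rc[OF z] proj_Base by simp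
  then show ?thesis
    using base_map_has_llp[OF l l_eq] projection_has_rlp[OF r rc] Hom_Cod[OF l] Hom_Dom[OF r] by metis
qed

section \<open>The generated weak factorization system\<close>

lemma rlp_llp_rlp: "S \<subseteq> Arr E \<Longrightarrow> rlp E (llp E (rlp E S)) = rlp E S"
  unfolding rlp_def llp_def by blast

theorem (in presentable_cat) small_object_argument_wfs:
  assumes S: "S \<subseteq> Arr E" "small \<kappa> S"
  shows "wfs E (llp E (rlp E S)) (rlp E S)"
proof -
  have "small \<kappa> (Dom E ` S)" "Dom E ` S \<subseteq> Obj E"
    using small_image[OF S(2)] S(1) Dom_Obj by auto
  then obtain \<theta> :: "'u rel" where \<theta>: "regular_cardinal \<theta>" "\<theta> <o \<kappa>"
      "\<forall>A\<in>Dom E ` S. small_for_chains E \<theta> A"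
    using common_chain_length by blast
  have "\<exists>l\<in>llp E (rlp E S). \<exists>r\<in>rlp E S. Cod E l = Dom E r \<and> r \<odot>\<^bsub>E\<^esub> l = f" if "f \<in> Arr E" for f
  proof -
    interpret small_object_argument \<kappa> E \<theta> S f
      by unfold_locales (use \<theta> S that in auto)
    show ?thesis by (rule factorization_exists)
  qed
  then show ?thesis
    unfolding wfs_def using rlp_llp_rlp[OF S(1)] by blast
qed

theorem proposition2p5:
  fixes \<kappa> :: "'u rel"
    and E :: "('o, 'm) cat"
    and T :: "('o, 'm, 'o, 'm) cfunctor"
    and \<delta> c :: "nat \<Rightarrow> 'o \<Rightarrow> 'm"
    and \<epsilon> :: "'o \<Rightarrow> 'm"
    and Cof TrivFib \<I> Fib TrivCof :: "'m set"
  assumes "inaccessible \<kappa>"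
    and "category E"
    and "locally_presentable \<kappa> E"
    and "locally_cartesian_closed E"
    and "functorial_cylinder E T \<delta>"
    and "cylinder_contractions E T \<delta> \<epsilon>"
    and "cylinder_connections E T \<delta> \<epsilon> c"
    and "has_right_adjoint E E T"
    and "suitable_wfs \<kappa> E T \<delta> Cof TrivFib"
    and "cofibrantly_generated_by \<kappa> E Cof TrivFib \<I>"
    and "Fib = rlp E (leibniz_generators E T \<delta> \<I>)"
    and "TrivCof = llp E Fib"
  shows "wfs E TrivCof Fib"
proof -
  interpret presentable_cat \<kappa> E
    by unfold_locales (use assms in auto)
  have I: "\<I> \<subseteq> Arr E" "small \<kappa> \<I>"
    using assms(10) unfolding cofibrantly_generated_by_def by auto
  have "leibniz E T \<delta> k i \<in> Arr E" if k: "k \<in> {0, 1}" and i: "i \<in> \<I>" for k i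
  proof -
    have iA: "i \<in> Arr E" using I i by blast
    have "\<delta> k (Dom E i) \<in> Hom E (Dom E i) (omap T (Dom E i))"
      using assms(5) k Dom_Obj[OF iA]
      unfolding functorial_cylinder_def is_nat_trans_def id_functor_def by auto
    \<comment> \<open>The Leibniz product is a definite description out of a chosen pushout; it is an arrow because
      the pushout exists.\<close>
    then have "\<exists>p q. is_pushout E (\<delta> k (Dom E i)) i p q"
      using pushout_exists in_Hom[OF iA] by blast
    then show ?thesis
      using leibniz_spec[OF category assms(5) k iA] Hom_Arr by metis
  qed
  then have "leibniz_generators E T \<delta> \<I> \<subseteq> Arr E"
    unfolding leibniz_generators_def by blast
  moreover have "leibniz_generators E T \<delta> \<I> = (\<lambda>(k, i). leibniz E T \<delta> k i) ` ({0, 1} \<times> \<I>)"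
    unfolding leibniz_generators_def by auto
  then have "small \<kappa> (leibniz_generators E T \<delta> \<I>)"
    using small_image[OF small_Sigma[OF small_finite[of "{0, 1 :: nat}"] I(2)]] by simp
  ultimately show ?thesis
    unfolding assms(11,12) by (rule small_object_argument_wfs)
qed

end
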